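(* Let $\Pi$ be a convex polygon in the Euclidean plane with vertex set $V=\{\mathbf v_1,\dots,\mathbf v_n\}$, $n\ge 3$, and let $D_n$ be the dihedral group of degree $n$ and order $2n$, acting on the chordal decompositions of $\Pi$. For each chordal decomposition $\delta$ of $\Pi$, the cartographic coordinate functions $$|\mathbf v\rangle_\kappa=\frac1{2n}\sum_{g\in D_n}|\mathbf v\rangle_{\delta g}\qquad(\mathbf v\in V)$$ specify a coordinate system $\kappa\colon V\to I^\Pi$, $\mathbf v\mapsto|\mathbf v\rangle_\kappa$, for $\Pi$.
   Context: Polygon. $\Pi$ is the convex hull in $\mathbb R^2$ of its extreme points (vertices) $\mathbf v_1,\dots,\mathbf v_n$, which are listed in counterclockwise order around the boundary. Its skeleton is the cyclic graph $C_n$ formed by the vertices and boundary edges. A chord is a segment connecting two vertices that are not adjacent in $C_n$. Coordinate system. Let $I=[0,1]$ and let $I^\Pi$ be the set of all functions $\Pi\to I$. A coordinate system for $\Pi$ is a map $\lambda\colon V\to I^\Pi$, $\mathbf v\mapsto|\mathbf v\rangle_\lambda$, with the value of $|\mathbf v\rangle_\lambda$ at $\mathbf a\in\Pi$ written $\langle\mathbf a|\mathbf v\rangle_\lambda$, such that every $\mathbf a\in\Pi$ is expressed as the barycentric combination $\mathbf a=\sum_{\mathbf v\in V}\langle\mathbf a|\mathbf v\rangle_\lambda\,\mathbf v$. Here "barycentric combination" means convex combination, so it is part of the meaning that the coefficients in $I$ satisfy $\sum_{\mathbf v\in V}\langle\mathbf a|\mathbf v\rangle_\lambda=1$. Chordal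 decomposition. A chordal decomposition $\delta$ of $\Pi$ is a system of $n-3$ non-crossing chords that decompose $\Pi$ as a union of $n-2$ (closed) triangles whose vertices are vertices of $\Pi$ (for $n=3$ the system is empty and the only triangle is $\Pi$). Let $T_\delta$ be the set of these $n-2$ triangles. Dihedral action. $D_n$ is the automorphism group of the graph $C_n$, acting on the right on the vertex indices $\{1,\dots,n\}$. For $g\in D_n$, $\delta g$ is the chordal decomposition whose chords are the segments joining $\mathbf v_{jg}$ and $\mathbf v_{kg}$, for each chord of $\delta$ joining $\mathbf v_j$ and $\mathbf v_k$; the polygon $\Pi$ and its vertex set are left fixed. Areal coordinates. For points $\mathbf x_0,\mathbf x_1,\mathbf x_2$ of the plane, $A(\mathbf x_0,\mathbf x_1,\mathbf x_2)=\tfrac12\det[\mathbf x_1-\mathbf x_0,\mathbf x_2-\mathbf x_0]$ is the signed area. For a triangle $\tau\in T_\delta$ with vertices $\mathbf w_0,\mathbf w_1,\mathbf w_2$ in cyclic counterclockwise order, and for $\mathbf x\in\tau$, the areal coordinate of $\mathbf x$ with respect to $\mathbf w_i$ is $$\langle\mathbf x|\mathbf w_i\rangle_\tau=\frac{A(\mathbf w_{i-1},\mathbf x,\mathbf w_{i+1})}{A(\mathbf w_0,\mathbf w_1,\mathbf w_2)}$$ with indices modulo $3$. Chordal coordinate functions. $\mathbf 1_X$ denotes the indicator function on $\Pi$ of a subset $X\subseteq\Pi$, and products of functions are pointwise; for $X\subseteq\tau$, the product $\mathbf 1_X\cdot|\mathbf v\rangle_\tau$ is the function equal to $\langle\mathbf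 x|\mathbf v\rangle_\tau$ at $\mathbf x\in X$ and $0$ elsewhere on $\Pi$. Fix $\mathbf v\in V$. For sets $S$ of triangles of $T_\delta$ having $\mathbf v$ as a vertex, define recursively $\bigodot_{\sigma\in\varnothing}\mathbf 1_\sigma\cdot|\mathbf v\rangle_\sigma=0$ and, for a further such triangle $\tau\notin S$, $$\bigodot_{\sigma\in S\cup\{\tau\}}\mathbf 1_\sigma\cdot|\mathbf v\rangle_\sigma=\bigodot_{\sigma\in S}\mathbf 1_\sigma\cdot|\mathbf v\rangle_\sigma+\mathbf 1_\tau\cdot|\mathbf v\rangle_\tau-\mathbf 1_{\tau\cap\bigcup\{\sigma\mid\sigma\in S\}}\cdot|\mathbf v\rangle_\tau$$ (the triangles being adjoined one at a time, in any order). The chordal coordinate function of $\delta$ at $\mathbf v$ is $$|\mathbf v\rangle_\delta=\bigodot_{\sigma\in\{\tau\in T_\delta\mid\mathbf v\in\tau\}}\mathbf 1_\sigma\cdot|\mathbf v\rangle_\sigma .$$ The functions $|\mathbf v\rangle_{\delta g}$ are the chordal coordinate functions of the chordal decomposition $\delta g$. *)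

theory Defs
  imports "HOL-Analysis.Analysis" "HOL-Combinatorics.Permutations"
begin

type_synonym point = "real^2"

definition signed_area :: "point \<Rightarrow> point \<Rightarrow> point \<Rightarrow> real" where
  "signed_area x0 x1 x2 = 1/2 * det (vector [x1 - x0, x2 - x0] :: real^2^2)"

text \<open>Indices run over \<open>{1..n}\<close>, so the cyclic successor of \<open>i\<close> is \<open>i mod n + 1\<close>.
  The last conjunct expresses the counterclockwise listing: the polygon lies to the left
  of every directed segment from a vertex to the next one. In particular these segments are
  the boundary edges.\<close>

definition convex_polygon :: "nat \<Rightarrow> (nat \<Rightarrow> point) \<Rightarrow> point set \<Rightarrow> bool" where
  "convex_polygon n v P \<longleftrightarrow>
     inj_on v {1..n} \<and>
     P = convex hull (v ` {1..n}) \<and>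
     {x. x extreme_point_of P} = v ` {1..n} \<and>
     (\<forall>i\<in>{1..n}. \<forall>x\<in>P. 0 \<le> signed_area (v i) (v (i mod n + 1)) x)"

definition coordinate_system ::
  "point set \<Rightarrow> point set \<Rightarrow> (point \<Rightarrow> point \<Rightarrow> real) \<Rightarrow> bool" where
  "coordinate_system P V l \<longleftrightarrow>
     l \<in> V \<rightarrow> (P \<rightarrow> {0..1}) \<and>
     (\<forall>a\<in>P. (\<Sum>w\<in>V. l w a) = 1 \<and> a = (\<Sum>w\<in>V. l w a *\<^sub>R w))"

definition cycle_adjacent :: "nat \<Rightarrow> nat \<Rightarrow> nat \<Rightarrow> bool" where
  "cycle_adjacent n i j \<longleftrightarrow>
     i \<in> {1..n} \<and> j \<in> {1..n} \<and> (j = i mod n + 1 \<or> i = j mod n + 1)"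

definition dihedral :: "nat \<Rightarrow> (nat \<Rightarrow> nat) set" where
  "dihedral n = {g. g permutes {1..n} \<and>
     (\<forall>i\<in>{1..n}. \<forall>j\<in>{1..n}. cycle_adjacent n (g i) (g j) \<longleftrightarrow> cycle_adjacent n i j)}"

definition chords :: "nat \<Rightarrow> (nat \<Rightarrow> point) \<Rightarrow> point set set" where
  "chords n v = {closed_segment (v j) (v k) | j k.
     j \<in> {1..n} \<and> k \<in> {1..n} \<and> j \<noteq> k \<and> \<not> cycle_adjacent n j k}"

text \<open>The closed pieces into which \<open>P\<close> is cut by the segments in \<open>\<delta>\<close>. For a chordal
  decomposition these are the triangles forming \<open>T\<^sub>\<delta>\<close>.\<close>

definition pieces :: "point set \<Rightarrow> point set set \<Rightarrow> point set set" where
  "pieces P \<delta> = closure ` components (P - \<Union>\<delta>)"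

text \<open>Non-crossing chords may share an endpoint; the relative interior of a nondegenerate
  closed segment is the open segment.\<close>

definition chordal_decomposition ::
  "nat \<Rightarrow> (nat \<Rightarrow> point) \<Rightarrow> point set \<Rightarrow> point set set \<Rightarrow> bool" where
  "chordal_decomposition n v P \<delta> \<longleftrightarrow>
     \<delta> \<subseteq> chords n v \<and> card \<delta> = n - 3 \<and>
     pairwise (\<lambda>c d. rel_interior c \<inter> rel_interior d = {}) \<delta> \<and>
     P = \<Union>(pieces P \<delta>) \<and> card (pieces P \<delta>) = n - 2 \<and>
     (\<forall>\<tau>\<in>pieces P \<delta>. \<exists>a b c. {a, b, c} \<subseteq> v ` {1..n} \<and> \<not> collinear {a, b, c} \<and>
        \<tau> = convex hull {a, b, c})"

text \<open>The right action of an index permutation on systems of segments joining vertices;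
  the image of the index \<open>j\<close> under \<open>g\<close> is \<open>g j\<close>.\<close>

definition act ::
  "nat \<Rightarrow> (nat \<Rightarrow> point) \<Rightarrow> point set set \<Rightarrow> (nat \<Rightarrow> nat) \<Rightarrow> point set set" where
  "act n v \<delta> g = {closed_segment (v (g j)) (v (g k)) | j k.
     j \<in> {1..n} \<and> k \<in> {1..n} \<and> closed_segment (v j) (v k) \<in> \<delta>}"

text \<open>The areal coordinate of \<open>x\<close> with respect to the vertex \<open>w\<close> of the triangle \<open>\<tau>\<close>. If \<open>w\<close> is
  the vertex with number \<open>i\<close> in counterclockwise order, then \<open>p\<close> and \<open>q\<close> are the vertices
  numbered \<open>i - 1\<close> and \<open>i + 1\<close> modulo 3; they are determined by \<open>\<tau>\<close> and \<open>w\<close>.\<close>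

definition areal :: "point set \<Rightarrow> point \<Rightarrow> point \<Rightarrow> real" where
  "areal \<tau> w x =
     (let (p, q) = (THE (p, q). \<tau> = convex hull {p, w, q} \<and> 0 < signed_area p w q)
      in signed_area p x q / signed_area p w q)"

text \<open>\<open>odot w S f\<close>: the function \<open>f\<close> is obtained by adjoining the triangles of \<open>S\<close> one at a
  time in some order. Functions on the polygon are represented by functions on the
  plane that vanish outside of it.\<close>

inductive odot :: "point \<Rightarrow> point set set \<Rightarrow> (point \<Rightarrow> real) \<Rightarrow> bool" for w where
  empty: "odot w {} (\<lambda>x. 0)"
| adjoin: "odot w S f \<Longrightarrow> \<tau> \<notin> S \<Longrightarrow>
    odot w (insert \<tau> S)
      (\<lambda>x. f x + indicator \<tau> x * areal \<tau> w x - indicator (\<tau> \<inter> \<Union>S) x * areal \<tau> w x)"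

text \<open>The result does not depend on the order of adjunction, hence the definite description.\<close>

definition chordal_coord :: "point set \<Rightarrow> point set set \<Rightarrow> point \<Rightarrow> point \<Rightarrow> real" where
  "chordal_coord P \<delta> w = (THE f. odot w {\<tau> \<in> pieces P \<delta>. w \<in> \<tau>} f)"

definition cartographic ::
  "nat \<Rightarrow> (nat \<Rightarrow> point) \<Rightarrow> point set \<Rightarrow> point set set \<Rightarrow> point \<Rightarrow> point \<Rightarrow> real" where
  "cartographic n v P \<delta> w x =
     1 / (2 * real n) * (\<Sum>g\<in>dihedral n. chordal_coord P (act n v \<delta> g) w x)"

end

theory Submission
  imports Defs
begin

text \<open>An average of coordinate systems is a coordinate system, and the dihedral group has \<open>2n\<close>
  elements (\<open>card_dihedral\<close>). So it suffices that the chordal coordinate functions of each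
  \<open>\<delta>g\<close> form a coordinate system.

  The chords of \<open>\<delta>g\<close> are the chords of \<open>\<delta>\<close> after the vertices are relabelled by \<open>g\<close>, and the
  relabelled vertices list the same polygon, counterclockwise or clockwise
  (\<open>convex_listing_relabel\<close>). In a convex listing the sign of the area of a triangle of
  vertices depends only on the order of its indices (\<open>side_increasing\<close>), so crossing is a property
  of index pairs. Hence \<open>\<delta>g\<close> comes from the same family of \<open>n - 3\<close> noncrossing index pairs as
  \<open>\<delta>\<close>, and the claim has to be proved only for such families in a convex listing.

  The polygon on the consecutive vertices \<open>i, \<dots>, k\<close> admits at most \<open>k - i - 1\<close> noncrossing index
  pairs, \<open>(i, k)\<close> included, and equality forces a triangle on the edge \<open>(i, k)\<close> with equality again in
  the two polygons beside it (\<open>tight_split\<close>). By induction the triangles with edges in the family cover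
  the polygon (\<open>triangles_cover\<close>). Two different triangles lie on opposite sides of a chord
  of the family (\<open>triangles_separated\<close>), and a point that is a convex combination on either side
  is a combination of the two ends of the chord, with uniquely determined weights
  (\<open>bary_separated\<close>). Therefore the barycentric weights of a point do not depend on the triangle
  that is used to compute them (\<open>bary_agree\<close>). The same separation shows that the triangles are
  the closures of the components of the complement of the chords (\<open>pieces_eq\<close>). Consequently the
  chordal coordinate of a vertex at a point is its weight in any triangle containing the point
  (\<open>chordal_coord_eq_bary\<close>), and these weights are nonnegative, have sum one and represent the
  point.\<close>

section \<open>Signed area and areal coordinates\<close>

lemma signed_area_eq:
  "signed_area x y z = 1/2 * ((y - x)$1 * (z - x)$2 - (z - x)$1 * (y - x)$2)"
  by (simp add: signed_area_def det_2 vector_2)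

lemma signed_area_rotate: "signed_area x y z = signed_area y z x"
  by (simp add: signed_area_eq algebra_simps)

lemma signed_area_swap: "signed_area x z y = - signed_area x y z"
  by (simp add: signed_area_eq algebra_simps)

lemma signed_area_degenerate [simp]:
  "signed_area x x z = 0" "signed_area x y x = 0" "signed_area x y y = 0"
  by (simp_all add: signed_area_eq)

lemma signed_area_affine:
  assumes "sum \<alpha> A = 1"
  shows "signed_area p q (\<Sum>m\<in>A. \<alpha> m *\<^sub>R u m) = (\<Sum>m\<in>A. \<alpha> m * signed_area p q (u m))"
proof -
  have "(\<Sum>m\<in>A. \<alpha> m *\<^sub>R u m) - p = (\<Sum>m\<in>A. \<alpha> m *\<^sub>R (u m - p))"
    using assms by (simp add: scaleR_diff_right sum_subtractf flip: scaleR_sum_left)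
  moreover define L where "L y = 1/2 * ((q - p)$1 * y$2 - y$1 * (q - p)$2)" for y :: point
  have "linear L"
    unfolding L_def by (rule linearI) (simp_all add: field_simps)
  then have "L (\<Sum>m\<in>A. \<alpha> m *\<^sub>R (u m - p)) = (\<Sum>m\<in>A. \<alpha> m * L (u m - p))"
    by (simp add: linear_sum linear_scale)
  moreover have "signed_area p q x = L (x - p)" for x
    by (simp add: signed_area_eq L_def)
  ultimately show ?thesis by simp
qed

lemma signed_area_segment:
  "signed_area p q ((1 - t) *\<^sub>R x + t *\<^sub>R y) = (1 - t) * signed_area p q x + t * signed_area p q y"
  by (simp add: signed_area_eq algebra_simps add_divide_distrib diff_divide_distrib)

lemma collinear_iff_signed_area: "collinear {a, b, c} \<longleftrightarrow> signed_area a b c = 0"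
proof -
  have eq: "collinear {a, b, c} \<longleftrightarrow> collinear {0, b - a, c - a}"
    using collinear_3[of b a c] by (simp add: insert_commute)
  show ?thesis
  proof
    assume "collinear {a, b, c}"
    then consider "b - a = 0" | "c - a = 0" | k where "c - a = k *\<^sub>R (b - a)"
      unfolding eq collinear_lemma by blast
    then show "signed_area a b c = 0"
      by cases (simp_all add: signed_area_eq)
  next
    assume 0: "signed_area a b c = 0"
    define x where "x = b - a" define y where "y = c - a"
    have d: "x$1 * y$2 = y$1 * x$2" using 0 by (simp add: signed_area_eq x_def y_def)
    have "x = 0 \<or> (\<exists>k. y = k *\<^sub>R x)"
    proof (cases "x$1 = 0")
      case True
      show ?thesis
      proof (cases "x$2 = 0")
        case True
        with \<open>x$1 = 0\<close> show ?thesis by (simp add: vec_eq_iff forall_2)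
      next
        case False
        with d True have "y = (y$2 / x$2) *\<^sub>R x" by (simp add: vec_eq_iff forall_2)
        then show ?thesis by blast
      qed
    next
      case False
      with d have "y = (y$1 / x$1) *\<^sub>R x" by (simp add: vec_eq_iff forall_2 field_simps)
      then show ?thesis by blast
    qed
    then show "collinear {a, b, c}" unfolding eq collinear_lemma x_def y_def by blast
  qed
qed

lemma extreme_points_triangle:
  assumes "signed_area a b c \<noteq> 0"
  shows "{x. x extreme_point_of convex hull {a, b, c}} = {a, b, c}"
proof -
  have "\<not> affine_dependent {a, b, c}"
    using assms collinear_3_eq_affine_dependent[of a b c] by (auto simp: collinear_iff_signed_area)
  then show ?thesis by (auto simp: extreme_point_of_convex_hull_affine_independent)
qed

text \<open>The numerator and the denominator of the areal coordinate are the values of one affine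
  function, which vanishes at the two other corners, so their ratio is the weight of the corner
  \<open>b\<close>. What needs an argument is that the definite description in \<open>areal\<close> has a value: a triangle
  determines its corners as its extreme points, and only one order of the two others is
  counterclockwise.\<close>

lemma areal_barycentric:
  assumes area: "signed_area a b c \<noteq> 0" and sum: "\<alpha> + \<beta> + \<gamma> = 1"
  shows "areal (convex hull {a, b, c}) b (\<alpha> *\<^sub>R a + \<beta> *\<^sub>R b + \<gamma> *\<^sub>R c) = \<beta>"
proof -
  let ?Q = "\<lambda>(p, q). convex hull {a, b, c} = convex hull {p, b, q} \<and> 0 < signed_area p b q"
  have swap: "signed_area y b x = - signed_area x b y" for x y
    by (simp add: signed_area_eq algebra_simps)
  have weight: "signed_area p (\<alpha>' *\<^sub>R p + \<beta>' *\<^sub>R b + \<gamma>' *\<^sub>R q) q = \<beta>' * signed_area p b q"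
    if "\<alpha>' + \<beta>' + \<gamma>' = 1" for p q \<alpha>' \<beta>' \<gamma>'
  proof -
    have eq: "\<alpha>' = 1 - \<beta>' - \<gamma>'" using that by simp
    show ?thesis unfolding eq by (simp add: signed_area_eq algebra_simps)
  qed
  have only: "(p, q) = (a, c) \<or> (p, q) = (c, a)" if "?Q (p, q)" for p q
  proof -
    have hull: "convex hull {a, b, c} = convex hull {p, b, q}" and pos: "0 < signed_area p b q"
      using that by auto
    have "{p, b, q} = {x. x extreme_point_of convex hull {p, b, q}}"
      using pos by (intro extreme_points_triangle[symmetric]) simp
    also have "\<dots> = {a, b, c}"
      using extreme_points_triangle[OF area] by (simp only: hull)
    finally have set: "{p, b, q} = {a, b, c}" .
    have "p \<noteq> b" "q \<noteq> b" "p \<noteq> q" using pos by auto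
    moreover have "p \<in> {a, b, c}" "q \<in> {a, b, c}" using set by blast+
    ultimately show ?thesis by auto
  qed
  \<comment> \<open>The two orders of the other vertices give opposite areas, so exactly one is counterclockwise.\<close>
  define pq where "pq = (if 0 < signed_area a b c then (a, c) else (c, a))"
  have Q: "?Q pq"
  proof (cases "0 < signed_area a b c")
    case False
    then have "0 < signed_area c b a" using area swap[of a c] by linarith
    then show ?thesis using False by (simp add: pq_def insert_commute)
  qed (simp add: pq_def)
  have "(THE pq. ?Q pq) = pq"
  proof (rule the_equality)
    show "?Q pq" by (fact Q)
  next
    fix r assume r: "?Q r"
    obtain p q where r_eq: "r = (p, q)" by (cases r)
    have "r = (a, c) \<and> 0 < signed_area a b c \<or> r = (c, a) \<and> 0 < signed_area c b a"
      using only[of p q] r unfolding r_eq by blast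
    then show "r = pq" using swap[of a c] by (auto simp: pq_def)
  qed
  then have areal: "areal (convex hull {a, b, c}) b x
      = (case pq of (p, q) \<Rightarrow> signed_area p x q / signed_area p b q)" for x
    by (simp add: areal_def Let_def)
  show ?thesis
  proof (cases "0 < signed_area a b c")
    case True
    then show ?thesis unfolding areal pq_def using weight[OF sum, of a c] by simp
  next
    case False
    have rev: "\<alpha> *\<^sub>R a + \<beta> *\<^sub>R b + \<gamma> *\<^sub>R c = \<gamma> *\<^sub>R c + \<beta> *\<^sub>R b + \<alpha> *\<^sub>R a"
      by (simp add: add_ac)
    have "\<gamma> + \<beta> + \<alpha> = 1" using sum by simp
    moreover have "signed_area c b a \<noteq> 0" using area swap[of a c] by linarith
    ultimately show ?thesis unfolding areal pq_def rev using False weight[of \<gamma> \<beta> \<alpha> c a] by simp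
  qed
qed

section \<open>Gluing areal coordinates along the triangles at a vertex\<close>

lemma odot_exists:
  assumes "finite S" shows "\<exists>f. odot w S f"
  using assms by induction (blast intro: odot.intros)+

text \<open>Where a new triangle overlaps the old ones, the correction term removes the new summand and
  keeps the old value. If the areal coordinates agree on overlaps, this value is the areal
  coordinate in any of the triangles that contain the point, whatever the order of adjunction.\<close>

lemma odot_values:
  assumes "odot w S f"
    and "\<And>\<tau> \<sigma> x. \<tau> \<in> S \<Longrightarrow> \<sigma> \<in> S \<Longrightarrow> x \<in> \<tau> \<Longrightarrow> x \<in> \<sigma> \<Longrightarrow> areal \<tau> w x = areal \<sigma> w x"
  shows "(\<forall>\<tau>\<in>S. \<forall>x\<in>\<tau>. f x = areal \<tau> w x) \<and> (\<forall>x. x \<notin> \<Union>S \<longrightarrow> f x = 0)"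
  using assms
proof induction
  case empty
  then show ?case by simp
next
  case (adjoin S f \<tau>)
  have IH: "(\<forall>\<sigma>\<in>S. \<forall>x\<in>\<sigma>. f x = areal \<sigma> w x)" "(\<forall>x. x \<notin> \<Union>S \<longrightarrow> f x = 0)"
    using adjoin.IH adjoin.prems by auto
  have agree: "areal \<tau> w x = areal \<sigma> w x" if "\<sigma> \<in> S" "x \<in> \<tau>" "x \<in> \<sigma>" for \<sigma> x
    using adjoin.prems that by blast
  show ?case
  proof (intro conjI ballI allI impI)
    fix \<sigma> x assume "\<sigma> \<in> insert \<tau> S" "x \<in> \<sigma>"
    then show "f x + indicator \<tau> x * areal \<tau> w x - indicator (\<tau> \<inter> \<Union>S) x * areal \<tau> w x
        = areal \<sigma> w x"
      using IH agree by (cases "x \<in> \<tau>"; cases "x \<in> \<Union>S") (auto simp: indicator_def)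
  next
    fix x assume "x \<notin> \<Union>(insert \<tau> S)"
    then show "f x + indicator \<tau> x * areal \<tau> w x - indicator (\<tau> \<inter> \<Union>S) x * areal \<tau> w x = 0"
      using IH by auto
  qed
qed

lemma chordal_coord_values:
  fixes P :: "point set" and \<delta> w
  defines "S \<equiv> {\<tau> \<in> pieces P \<delta>. w \<in> \<tau>}"
  assumes fin: "finite S"
    and agree: "\<And>\<tau> \<sigma> x. \<tau> \<in> S \<Longrightarrow> \<sigma> \<in> S \<Longrightarrow> x \<in> \<tau> \<Longrightarrow> x \<in> \<sigma> \<Longrightarrow> areal \<tau> w x = areal \<sigma> w x"
  shows "\<tau> \<in> S \<Longrightarrow> x \<in> \<tau> \<Longrightarrow> chordal_coord P \<delta> w x = areal \<tau> w x"
    and "x \<notin> \<Union>S \<Longrightarrow> chordal_coord P \<delta> w x = 0"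
proof -
  obtain f where f: "odot w S f" using odot_exists[OF fin] by blast
  have "g = f" if "odot w S g" for g
  proof
    fix x
    show "g x = f x"
      using odot_values[OF f agree] odot_values[OF that agree] by (cases "x \<in> \<Union>S") auto
  qed
  then have "chordal_coord P \<delta> w = f"
    using f unfolding chordal_coord_def S_def by blast
  then show "\<tau> \<in> S \<Longrightarrow> x \<in> \<tau> \<Longrightarrow> chordal_coord P \<delta> w x = areal \<tau> w x"
    and "x \<notin> \<Union>S \<Longrightarrow> chordal_coord P \<delta> w x = 0"
    using odot_values[OF f agree] by auto
qed

section \<open>Finite closed partitions and components\<close>

text \<open>In a finite partition into closed sets each member is also open, so it cannot be a proper
  part of a component.\<close>

lemma components_of_closed_partition:
  assumes fin: "finite \<C>" and cover: "\<Union>\<C> = X"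
    and closed: "\<And>C. C \<in> \<C> \<Longrightarrow> closedin (top_of_set X) C"
    and conn: "\<And>C. C \<in> \<C> \<Longrightarrow> connected C \<and> C \<noteq> {}"
    and disj: "pairwise disjnt \<C>"
  shows "components X = \<C>"
proof -
  have eq: "K = C" if K: "K \<in> components X" and C: "C \<in> \<C>" and meet: "K \<inter> C \<noteq> {}" for K C
  proof -
    have "C \<subseteq> K" using components_maximal[OF K] conn[OF C] cover C meet by blast
    have rel: "closedin (top_of_set K) (K \<inter> F)" if "closedin (top_of_set X) F" for F
      using that in_components_subset[OF K] by (auto simp: closedin_closed Int_absorb1)
    let ?D = "\<Union>(\<C> - {C})"
    have "closedin (top_of_set X) ?D" using fin closed by (intro closedin_Union) auto
    then have cl: "closedin (top_of_set K) (K \<inter> C)" "closedin (top_of_set K) (K \<inter> ?D)"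
      using rel closed[OF C] by blast+
    have "K \<inter> C \<inter> (K \<inter> ?D) = {}" using disj C by (auto simp: pairwise_def disjnt_def)
    moreover have "K \<inter> C \<union> K \<inter> ?D = K" using in_components_subset[OF K] cover by blast
    moreover have "connected K" using K by (rule in_components_connected)
    ultimately have "K \<inter> ?D = {}"
      using meet cl unfolding connected_closedin_eq by blast
    then have "K \<subseteq> C" using in_components_subset[OF K] cover by blast
    with \<open>C \<subseteq> K\<close> show ?thesis by blast
  qed
  have "K \<in> \<C>" if K: "K \<in> components X" for K
  proof -
    obtain x where "x \<in> K" using in_components_nonempty[OF K] by blast
    then obtain C where "C \<in> \<C>" "x \<in> C" using in_components_subset[OF K] cover by blast
    then show ?thesis using eq[OF K] \<open>x \<in> K\<close> by blast
  qed
  moreover have "C \<in> components X" if C: "C \<in> \<C>" for C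
  proof -
    obtain x where "x \<in> C" using conn[OF C] by blast
    then obtain K where "K \<in> components X" "x \<in> K"
      using C cover Union_components[of X] by (metis UnionE UnionI)
    then show ?thesis using eq[OF _ C] \<open>x \<in> C\<close> by blast
  qed
  ultimately show ?thesis by blast
qed

section \<open>Convex polygons listed around their boundary\<close>

text \<open>Write \<open>x\<close> as a point between a combination \<open>y\<close> of the generators on the nonpositive side and
  a combination \<open>z\<close> of the others. The way from \<open>y\<close> to \<open>z\<close> leaves the nonpositive side through
  the zero set, after \<open>x\<close>; so \<open>x\<close> also lies between \<open>y\<close> and a point of the zero set.\<close>

lemma convex_hull_halfspace:
  fixes f :: "'a::euclidean_space \<Rightarrow> real"
  assumes affine: "\<And>x y t. f ((1 - t) *\<^sub>R x + t *\<^sub>R y) = (1 - t) * f x + t * f y"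
    and cut: "\<And>w. w \<in> convex hull S \<Longrightarrow> f w = 0 \<Longrightarrow> w \<in> convex hull {y\<in>S. f y \<le> 0}"
    and x: "x \<in> convex hull S" "f x \<le> 0"
  shows "x \<in> convex hull {y\<in>S. f y \<le> 0}"
proof -
  define A where "A = {y\<in>S. f y \<le> 0}"
  define B where "B = {y\<in>S. f y \<ge> 0}"
  have convexI': "convex {y. s * f y \<ge> 0}" for s
  proof (rule convexI)
    fix y z and t r :: real
    assume yz: "y \<in> {y. s * f y \<ge> 0}" "z \<in> {y. s * f y \<ge> 0}" and t: "0 \<le> t" "0 \<le> r" "t + r = 1"
    have t_eq: "t = 1 - r" using t by simp
    have "s * f (t *\<^sub>R y + r *\<^sub>R z) = t * (s * f y) + r * (s * f z)"
      unfolding t_eq affine by (simp add: algebra_simps)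
    also have "\<dots> \<ge> 0" using yz t by simp
    finally show "t *\<^sub>R y + r *\<^sub>R z \<in> {y. s * f y \<ge> 0}" by simp
  qed
  have "convex hull A \<subseteq> {y. - 1 * f y \<ge> 0}"
    by (rule hull_minimal[of A "{y. - 1 * f y \<ge> 0}" convex]) (auto simp: A_def intro: convexI'[of "- 1", simplified])
  then have A_neg: "f y \<le> 0" if "y \<in> convex hull A" for y using that by auto
  have "convex hull B \<subseteq> {y. 1 * f y \<ge> 0}"
    by (rule hull_minimal[of B "{y. 1 * f y \<ge> 0}" convex]) (auto simp: B_def intro: convexI'[of 1, simplified])
  then have B_pos: "f y \<ge> 0" if "y \<in> convex hull B" for y using that by auto
  have S: "S = A \<union> B" by (auto simp: A_def B_def)
  show ?thesis
  proof (cases "f x = 0 \<or> B = {}")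
    case True
    then show ?thesis using cut x S unfolding A_def by auto
  next
    case False
    then have neg: "f x < 0" and "B \<noteq> {}" using x by auto
    have "A \<noteq> {}"
    proof
      assume "A = {}"
      then have "f x \<ge> 0" using B_pos x S by simp
      with neg show False by simp
    qed
    have "x \<in> convex hull (convex hull A \<union> convex hull B)"
      using x(1) unfolding S by (rule subsetD[OF hull_mono, rotated]) (auto intro: hull_inc)
    then obtain t r y z where "0 \<le> t" "0 \<le> r" "t + r = 1" and yz: "y \<in> convex hull A" "z \<in> convex hull B"
      and "x = t *\<^sub>R y + r *\<^sub>R z"
      using convex_hull_union_two[of "convex hull A" "convex hull B"] \<open>A \<noteq> {}\<close> \<open>B \<noteq> {}\<close> by auto
    have t_eq: "t = 1 - r" and r: "0 \<le> r" "r \<le> 1" using \<open>t + r = 1\<close> \<open>0 \<le> t\<close> \<open>0 \<le> r\<close> by linarith+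
    have xr: "x = (1 - r) *\<^sub>R y + r *\<^sub>R z" using \<open>x = _\<close> unfolding t_eq .
    have fx: "(1 - r) * f y + r * f z < 0" using neg affine unfolding xr by simp
    have fy: "f y < 0" and fz: "f z \<ge> 0"
    proof -
      show "f z \<ge> 0" using B_pos yz by blast
      then have "r * f z \<ge> 0" using r by simp
      then show "f y < 0" using fx A_neg[OF yz(1)] by (cases "f y = 0") auto
    qed
    \<comment> \<open>The segment from \<open>y\<close> to \<open>z\<close> passes \<open>x\<close> before it meets the zero set of \<open>f\<close> in \<open>w\<close>.\<close>
    define s where "s = - f y / (f z - f y)"
    define w where "w = (1 - s) *\<^sub>R y + s *\<^sub>R z"
    have s: "0 < s" "s \<le> 1" using fy fz by (auto simp: s_def field_simps)
    have "f w = f y + s * (f z - f y)" unfolding w_def affine by (simp add: algebra_simps)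
    then have "f w = 0" using fy fz by (simp add: s_def)
    moreover have "w \<in> convex hull S"
      unfolding w_def using yz s hull_mono[of A S] hull_mono[of B S] S
      by (intro convexD) (auto simp: subset_iff)
    ultimately have wA: "w \<in> convex hull A" using cut unfolding A_def by blast
    have "s * (f z - f y) = - f y" using fy fz by (simp add: s_def)
    then have "r * (f z - f y) < s * (f z - f y)" using fx by (simp add: algebra_simps)
    then have "r \<le> s" using fy fz by (meson diff_ge_0_iff_ge le_less mult_right_less_imp_less order_trans)
    define k where "k = r / s"
    have rk: "r = k * s" and k: "0 \<le> k" "k \<le> 1" using s r \<open>r \<le> s\<close> by (auto simp: k_def)
    have "x = (1 - k) *\<^sub>R y + k *\<^sub>R w"
      unfolding xr w_def rk by (simp add: algebra_simps)
    also have "\<dots> \<in> convex hull A"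
      using yz(1) wA k by (intro convexD) auto
    finally show ?thesis unfolding A_def .
  qed
qed

text \<open>The sign \<open>\<epsilon>\<close> is \<open>1\<close> for a counterclockwise and \<open>-1\<close> for a clockwise listing. Both
  occur among the relabellings of one polygon by the dihedral group, and everything below is
  proved for both at once.\<close>

locale convex_listing =
  fixes n :: nat and u :: "nat \<Rightarrow> point" and P :: "point set" and \<epsilon> :: real
  assumes n_ge_3: "n \<ge> 3" and orientation: "\<epsilon> = 1 \<or> \<epsilon> = -1"
    and inj: "inj_on u {1..n}"
    and hull: "P = convex hull (u ` {1..n})"
    and extreme: "{x. x extreme_point_of P} = u ` {1..n}"
    and boundary: "\<And>i x. i \<in> {1..n} \<Longrightarrow> x \<in> P \<Longrightarrow> 0 \<le> \<epsilon> * signed_area (u i) (u (i mod n + 1)) x"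
begin

definition side :: "nat \<Rightarrow> nat \<Rightarrow> point \<Rightarrow> real" where
  "side p q x = \<epsilon> * signed_area (u p) (u q) x"

lemma side_rotate: "side i j (u k) = side j k (u i)"
  unfolding side_def by (subst signed_area_rotate) simp

lemma side_swap: "side i k (u j) = - side i j (u k)"
  unfolding side_def by (subst signed_area_swap) simp

lemma side_degenerate [simp]: "side i j (u i) = 0" "side i j (u j) = 0"
  by (simp_all add: side_def)

lemma side_segment: "side p q ((1 - t) *\<^sub>R x + t *\<^sub>R y) = (1 - t) * side p q x + t * side p q y"
  unfolding side_def signed_area_segment by (simp add: algebra_simps)

lemma vertex_in: "m \<in> {1..n} \<Longrightarrow> u m \<in> P"
  unfolding hull by (intro hull_inc) auto

lemma vertex_extreme:
  assumes "m \<in> {1..n}" "x \<in> P" "y \<in> P" "u m \<in> closed_segment x y"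
  shows "u m = x \<or> u m = y"
proof -
  have "u m extreme_point_of P" using extreme assms(1) by blast
  then show ?thesis using assms(2-4) by (auto simp: extreme_point_of_def open_segment_def)
qed

text \<open>A point of \<open>P\<close> on the line, but beyond one of the two vertices, would make that vertex an inner
  point of a segment in \<open>P\<close>.\<close>

lemma line_inter_polygon:
  assumes pq: "p \<in> {1..n}" "q \<in> {1..n}" "p \<noteq> q" and w: "w \<in> P" "side p q w = 0"
  shows "w \<in> closed_segment (u p) (u q)"
proof -
  have ne: "u p \<noteq> u q" using pq inj by (auto dest: inj_onD)
  have "collinear {u p, u q, w}"
    using w orientation by (auto simp: collinear_iff_signed_area side_def)
  then consider "u p \<in> closed_segment (u q) w" | "u q \<in> closed_segment w (u p)"
    | "w \<in> closed_segment (u p) (u q)"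
    unfolding collinear_between_cases between_mem_segment by blast
  then show ?thesis
    using vertex_extreme[of p "u q" w] vertex_extreme[of q w "u p"] pq w ne vertex_in by cases auto
qed

lemma side_nonzero:
  assumes "{i, j, k} \<subseteq> {1..n}" "i \<noteq> j" "i \<noteq> k" "j \<noteq> k"
  shows "side i j (u k) \<noteq> 0"
proof
  assume "side i j (u k) = 0"
  then have "u k \<in> closed_segment (u i) (u j)"
    using assms vertex_in by (intro line_inter_polygon) auto
  then show False
    using vertex_extreme[of k "u i" "u j"] assms vertex_in inj by (auto dest: inj_onD)
qed

lemma side_consecutive:
  assumes "1 \<le> i" "i < n" "k \<in> {1..n}" "k \<noteq> i" "k \<noteq> Suc i"
  shows "side i (Suc i) (u k) > 0"
  using boundary[of i "u k"] side_nonzero[of i "Suc i" k] vertex_in[of k] assms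
  by (auto simp: side_def less_le)

lemma side_Pluecker:
  "side i e (u b) * side i a (u c) = side i e (u a) * side i b (u c) + side i a (u b) * side i e (u c)"
proof -
  have det: "(e1 * b2 - b1 * e2) * (a1 * c2 - c1 * a2)
      = (e1 * a2 - a1 * e2) * (b1 * c2 - c1 * b2) + (a1 * b2 - b1 * a2) * (e1 * c2 - c1 * e2)"
    for a1 a2 b1 b2 c1 c2 e1 e2 :: real
    by (simp add: algebra_simps)
  have "signed_area (u i) (u e) (u b) * signed_area (u i) (u a) (u c)
      = signed_area (u i) (u e) (u a) * signed_area (u i) (u b) (u c)
        + signed_area (u i) (u a) (u b) * signed_area (u i) (u e) (u c)"
    using det[of "(u e - u i)$1" "(u b - u i)$2" "(u b - u i)$1" "(u e - u i)$2"
      "(u a - u i)$1" "(u c - u i)$2" "(u c - u i)$1" "(u a - u i)$2"]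
    unfolding signed_area_eq by linarith
  then have "\<epsilon>^2 * (signed_area (u i) (u e) (u b) * signed_area (u i) (u a) (u c))
      = \<epsilon>^2 * (signed_area (u i) (u e) (u a) * signed_area (u i) (u b) (u c)
        + signed_area (u i) (u a) (u b) * signed_area (u i) (u e) (u c))" by simp
  then show ?thesis unfolding side_def by (simp only: power2_eq_square distrib_left mult_ac)
qed

text \<open>Seen from the vertex \<open>i\<close>, the later vertices lie on the inner side of the boundary edge
  from \<open>i\<close> to \<open>i + 1\<close>, and each is further round than its predecessor. Inside a half-plane
  this relation between directions is transitive, which is what the Pluecker relation
  expresses.\<close>

lemma side_increasing:
  assumes "1 \<le> i" "i < j" "j < k" "k \<le> n"
  shows "side i j (u k) > 0"
proof (cases "j = Suc i")
  case True
  then show ?thesis using side_consecutive[of i k] assms by auto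
next
  case False
  have "Suc j \<le> k" using assms by simp
  then show ?thesis using assms(4)
  proof (induction k rule: dec_induct)
    case base
    then show ?case using side_consecutive[of j i] side_rotate[of i j "Suc j"] assms by auto
  next
    case (step k)
    have "0 < side i (Suc i) (u j)" "0 < side i (Suc i) (u k)" "0 < side i (Suc i) (u (Suc k))"
      using step assms False by (auto intro!: side_consecutive)
    moreover have "0 < side i k (u (Suc k))"
      using side_consecutive[of k i] side_rotate[of i k "Suc k"] step assms by auto
    moreover have "0 < side i j (u k)" using step by simp
    ultimately have "0 < side i (Suc i) (u k) * side i j (u (Suc k))"
      unfolding side_Pluecker[of i "Suc i" k j "Suc k"] by (simp add: add_pos_pos)
    then show ?case using \<open>0 < side i (Suc i) (u k)\<close> by (simp add: zero_less_mult_iff)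
  qed
qed

lemma side_inside:
  assumes "1 \<le> p" "p < m" "m < q" "q \<le> n"
  shows "side p q (u m) < 0"
  using side_increasing[OF assms] side_swap[of p q m] by simp

lemma side_outside:
  assumes "1 \<le> p" "p < q" "q \<le> n" "m \<in> {1..n}" "m < p \<or> q < m"
  shows "side p q (u m) > 0"
  using assms side_increasing[of p q m] side_increasing[of m p q] side_rotate[of m p q] by auto

lemma side_sign_iff:
  assumes "1 \<le> p" "p < q" "q \<le> n" "m \<in> {1..n}"
  shows "side p q (u m) \<le> 0 \<longleftrightarrow> m \<in> {p..q}" and "0 \<le> side p q (u m) \<longleftrightarrow> m \<notin> {p<..<q}"
proof -
  consider "m = p" | "m = q" | "p < m" "m < q" | "m < p \<or> q < m" by linarith
  then have "(side p q (u m) \<le> 0 \<longleftrightarrow> m \<in> {p..q}) \<and> (0 \<le> side p q (u m) \<longleftrightarrow> m \<notin> {p<..<q})"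
  proof cases
    case 3
    then show ?thesis using side_inside[of p m q] assms by simp
  next
    case 4
    then show ?thesis using side_outside[of p q m] assms by (simp add: not_le) linarith
  qed (use assms in auto)
  then show "side p q (u m) \<le> 0 \<longleftrightarrow> m \<in> {p..q}" "0 \<le> side p q (u m) \<longleftrightarrow> m \<notin> {p<..<q}"
    by blast+
qed

section \<open>Barycentric weights and separating chords\<close>

text \<open>The barycentric weights of \<open>x\<close> over the vertices with indices in \<open>S\<close>. They are kept as
  functions on all indices, zero outside \<open>S\<close>, so that weights over different sets of vertices can
  be compared by plain equality.\<close>

definition bary :: "(nat \<Rightarrow> real) \<Rightarrow> nat set \<Rightarrow> point \<Rightarrow> bool" where
  "bary \<alpha> S x \<longleftrightarrow> (\<forall>m. 0 \<le> \<alpha> m) \<and> (\<forall>m. m \<notin> S \<longrightarrow> \<alpha> m = 0) \<and>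
     sum \<alpha> {1..n} = 1 \<and> (\<Sum>m\<in>{1..n}. \<alpha> m *\<^sub>R u m) = x"

lemma in_hull_iff_bary:
  assumes "S \<subseteq> {1..n}"
  shows "x \<in> convex hull (u ` S) \<longleftrightarrow> (\<exists>\<alpha>. bary \<alpha> S x)"
proof
  have fin: "finite S" and injS: "inj_on u S"
    using assms finite_subset inj inj_on_subset by blast+
  assume "x \<in> convex hull (u ` S)"
  then obtain c where c: "\<forall>y\<in>u ` S. 0 \<le> c y" "sum c (u ` S) = 1" "(\<Sum>y\<in>u ` S. c y *\<^sub>R y) = x"
    using fin by (auto simp: convex_hull_finite)
  define \<alpha> where "\<alpha> m = (if m \<in> S then c (u m) else 0)" for m
  have "sum \<alpha> {1..n} = sum \<alpha> S" "(\<Sum>m\<in>{1..n}. \<alpha> m *\<^sub>R u m) = (\<Sum>m\<in>S. \<alpha> m *\<^sub>R u m)"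
    by (rule sum.mono_neutral_right; use assms in \<open>auto simp: \<alpha>_def\<close>)+
  then have "bary \<alpha> S x"
    using c injS by (auto simp: bary_def \<alpha>_def sum.reindex)
  then show "\<exists>\<alpha>. bary \<alpha> S x" by blast
next
  assume "\<exists>\<alpha>. bary \<alpha> S x"
  then obtain \<alpha> where \<alpha>: "bary \<alpha> S x" by blast
  have "sum \<alpha> {1..n} = sum \<alpha> S" "(\<Sum>m\<in>{1..n}. \<alpha> m *\<^sub>R u m) = (\<Sum>m\<in>S. \<alpha> m *\<^sub>R u m)"
    by (rule sum.mono_neutral_right; use assms \<alpha> in \<open>auto simp: bary_def\<close>)+
  moreover have "(\<Sum>m\<in>S. \<alpha> m *\<^sub>R u m) \<in> convex hull (u ` S)" if "sum \<alpha> S = 1"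
    using that \<alpha> assms finite_subset by (intro convex_sum) (auto simp: bary_def intro: hull_inc)
  ultimately show "x \<in> convex hull (u ` S)" using \<alpha> by (auto simp: bary_def)
qed

lemma side_bary:
  assumes "bary \<alpha> S x"
  shows "side p q x = (\<Sum>m\<in>{1..n}. \<alpha> m * side p q (u m))"
  using assms signed_area_affine[of \<alpha> "{1..n}" "u p" "u q" u]
  by (auto simp: bary_def side_def sum_distrib_left mult_ac)

text \<open>The line through the vertices \<open>p\<close> and \<open>q\<close> has exactly the vertices strictly between
  \<open>p\<close> and \<open>q\<close> on its negative side. So this condition on indices says that the chord has the
  polygon on \<open>S\<close> on one side and the polygon on \<open>S'\<close> on the other.\<close>

definition separated :: "nat \<Rightarrow> nat \<Rightarrow> nat set \<Rightarrow> nat set \<Rightarrow> bool" where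
  "separated p q S S' \<longleftrightarrow> 1 \<le> p \<and> p < q \<and> q \<le> n \<and> S \<subseteq> {p..q} \<and> S' \<subseteq> {1..n} - {p<..<q}"

text \<open>The weighted mean of numbers of one sign vanishes only if all weight is on zeros, and the
  vertices \<open>p\<close> and \<open>q\<close> are the only ones on their line.\<close>

lemma bary_side_zero:
  assumes bary: "bary \<alpha> S x" and pq: "1 \<le> p" "p < q" "q \<le> n" and zero: "side p q x = 0"
    and S: "S \<subseteq> {p..q} \<or> S \<subseteq> {1..n} - {p<..<q}" and m: "m \<notin> {p, q}"
  shows "\<alpha> m = 0"
proof (rule ccontr)
  assume nz: "\<alpha> m \<noteq> 0"
  then have mS: "m \<in> S" and pos: "\<alpha> m > 0" using bary by (auto simp: bary_def less_le)
  have m1: "m \<in> {1..n}" using S mS pq by auto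
  define s :: real where "s = (if S \<subseteq> {p..q} then - 1 else 1)"
  have sgn: "0 \<le> s * side p q (u k)" if "k \<in> S" for k
  proof -
    have "k \<in> {1..n}" using that S pq by auto
    then show ?thesis using that S side_sign_iff[OF pq, of k] by (auto simp: s_def)
  qed
  have "side p q (u m) \<noteq> 0" using side_nonzero[of p q m] pq m m1 by auto
  then have s_m: "s * side p q (u m) > 0" using sgn[OF mS] by (auto simp: s_def less_le)
  have nonneg: "0 \<le> \<alpha> k * (s * side p q (u k))" for k
    using sgn bary by (cases "k \<in> S") (auto simp: bary_def)
  have "(\<Sum>k\<in>{1..n}. \<alpha> k * (s * side p q (u k))) = s * side p q x"
    unfolding side_bary[OF bary] sum_distrib_left by (simp add: mult_ac)
  then have "(\<Sum>k\<in>{1..n}. \<alpha> k * (s * side p q (u k))) = 0" using zero by simp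
  then have "\<alpha> m * (s * side p q (u m)) = 0"
    using nonneg m1 by (subst (asm) sum_nonneg_eq_0_iff) auto
  then show False using pos s_m by auto
qed

lemma side_separated:
  assumes "separated p q S S'" "bary \<alpha> S x" "bary \<beta> S' x"
  shows "side p q x = 0"
proof -
  have pq: "1 \<le> p" "p < q" "q \<le> n" "S \<subseteq> {p..q}" "S' \<subseteq> {1..n} - {p<..<q}"
    using assms(1) by (auto simp: separated_def)
  have "\<alpha> m * side p q (u m) \<le> 0" for m
  proof (cases "m \<in> S")
    case True
    then have "m \<in> {p..q}" "m \<in> {1..n}" using pq by auto
    then have "side p q (u m) \<le> 0" using side_sign_iff(1)[OF pq(1-3)] by blast
    then show ?thesis using assms(2) by (simp add: bary_def mult_nonneg_nonpos)
  qed (use assms(2) in \<open>simp add: bary_def\<close>)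
  then have "side p q x \<le> 0" unfolding side_bary[OF assms(2)] by (simp add: sum_nonpos)
  moreover have "0 \<le> \<beta> m * side p q (u m)" for m
  proof (cases "m \<in> S'")
    case True
    then have "m \<notin> {p<..<q}" "m \<in> {1..n}" using pq by auto
    then have "0 \<le> side p q (u m)" using side_sign_iff(2)[OF pq(1-3)] by blast
    then show ?thesis using assms(3) by (simp add: bary_def)
  qed (use assms(3) in \<open>simp add: bary_def\<close>)
  then have "side p q x \<ge> 0" unfolding side_bary[OF assms(3)] by (simp add: sum_nonneg)
  ultimately show ?thesis by simp
qed

text \<open>A common point of two separated polygons lies on the separating chord, hence is a
  combination of the two ends of that chord only, and such a combination is unique.\<close>

lemma bary_separated:
  assumes sep: "separated p q S S'" and \<alpha>: "bary \<alpha> S x" and \<beta>: "bary \<beta> S' x"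
  shows "\<alpha> = \<beta>" and "m \<notin> {p, q} \<Longrightarrow> \<alpha> m = 0"
proof -
  have pq: "1 \<le> p" "p < q" "q \<le> n" "S \<subseteq> {p..q}" "S' \<subseteq> {1..n} - {p<..<q}"
    using sep by (auto simp: separated_def)
  note zero = side_separated[OF assms]
  have \<alpha>0: "\<alpha> m = 0" and \<beta>0: "\<beta> m = 0" if "m \<notin> {p, q}" for m
    using bary_side_zero[OF \<alpha> pq(1-3) zero _ that] bary_side_zero[OF \<beta> pq(1-3) zero _ that] pq
    by blast+
  have "sum \<gamma> {1..n} = \<gamma> p + \<gamma> q \<and> (\<Sum>m\<in>{1..n}. \<gamma> m *\<^sub>R u m) = \<gamma> p *\<^sub>R u p + \<gamma> q *\<^sub>R u q"
    if "\<And>m. m \<notin> {p, q} \<Longrightarrow> \<gamma> m = 0" for \<gamma>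
  proof -
    have "sum \<gamma> {1..n} = sum \<gamma> {p, q}" "(\<Sum>m\<in>{1..n}. \<gamma> m *\<^sub>R u m) = (\<Sum>m\<in>{p, q}. \<gamma> m *\<^sub>R u m)"
      by (rule sum.mono_neutral_right; use pq that in auto)+
    then show ?thesis using pq by simp
  qed
  from this[of \<alpha>, OF \<alpha>0] this[of \<beta>, OF \<beta>0]
  have "\<alpha> p + \<alpha> q = 1" "\<beta> p + \<beta> q = 1" and
    eq: "\<alpha> p *\<^sub>R u p + \<alpha> q *\<^sub>R u q = \<beta> p *\<^sub>R u p + \<beta> q *\<^sub>R u q"
    using \<alpha> \<beta> by (auto simp: bary_def)
  then have "\<alpha> p = 1 - \<alpha> q" "\<beta> p = 1 - \<beta> q" by auto
  with eq have "(\<alpha> q - \<beta> q) *\<^sub>R (u q - u p) = 0" by (simp add: algebra_simps)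
  moreover have "u p \<noteq> u q" using inj pq by (auto dest: inj_onD)
  ultimately have "\<alpha> q = \<beta> q" by simp
  then have "\<alpha> m = \<beta> m" for m
    using \<alpha>0[of m] \<beta>0[of m] \<open>\<alpha> p = 1 - \<alpha> q\<close> \<open>\<beta> p = 1 - \<beta> q\<close> by (cases "m \<in> {p, q}") auto
  then show "\<alpha> = \<beta>" by blast
  show "m \<notin> {p, q} \<Longrightarrow> \<alpha> m = 0" by (fact \<alpha>0)
qed

lemma bary_triangle_unique:
  assumes abc: "a < b" "b < c" "{a, b, c} \<subseteq> {1..n}"
    and \<alpha>: "bary \<alpha> {a, b, c} x" and \<beta>: "bary \<beta> {a, b, c} x"
  shows "\<alpha> = \<beta>"
proof -
  have sum3: "side p q x = \<gamma> a * side p q (u a) + \<gamma> b * side p q (u b) + \<gamma> c * side p q (u c)"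
    if "bary \<gamma> {a, b, c} x" for \<gamma> p q
  proof -
    have "side p q x = (\<Sum>m\<in>{a, b, c}. \<gamma> m * side p q (u m))"
      unfolding side_bary[OF that] using abc that
      by (intro sum.mono_neutral_right) (auto simp: bary_def)
    then show ?thesis using abc by simp
  qed
  have "\<alpha> c = \<beta> c" "\<alpha> a = \<beta> a" "\<alpha> b = \<beta> b"
    using sum3[OF \<alpha>, of a b] sum3[OF \<beta>, of a b] sum3[OF \<alpha>, of b c] sum3[OF \<beta>, of b c]
      sum3[OF \<alpha>, of a c] sum3[OF \<beta>, of a c] abc
      side_nonzero[of a b c] side_nonzero[of b c a] side_nonzero[of a c b] by auto
  then have "\<alpha> m = \<beta> m" for m
    using \<alpha> \<beta> by (cases "m \<in> {a, b, c}") (auto simp: bary_def)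
  then show ?thesis by blast
qed

lemma vertex_in_hull_iff:
  assumes "m \<in> {1..n}" "S \<subseteq> {1..n}"
  shows "u m \<in> convex hull (u ` S) \<longleftrightarrow> m \<in> S"
proof
  assume m: "u m \<in> convex hull (u ` S)"
  have sub: "convex hull (u ` S) \<subseteq> P" unfolding hull using assms by (intro hull_mono) auto
  have "u m extreme_point_of P" using extreme assms by blast
  then have "u m extreme_point_of convex hull (u ` S)"
    using m sub by (auto simp: extreme_point_of_def)
  then have "u m \<in> u ` S" by (rule extreme_point_of_convex_hull)
  then show "m \<in> S" using inj assms by (auto dest: inj_onD)
qed (auto intro: hull_inc)

text \<open>The line through \<open>p\<close> and \<open>q\<close> meets the polygon only in the chord, whose ends belong to both
  halves.\<close>

lemma half_polygon:
  assumes pq: "1 \<le> p" "p < q" "q \<le> n" "p \<in> S" "q \<in> S" "S \<subseteq> {1..n}"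
    and x: "x \<in> convex hull (u ` S)"
  shows "side p q x \<le> 0 \<Longrightarrow> x \<in> convex hull (u ` (S \<inter> {p..q}))"
    and "side p q x \<ge> 0 \<Longrightarrow> x \<in> convex hull (u ` (S - {p<..<q}))"
proof -
  have seg: "w \<in> convex hull (u ` S')"
    if "w \<in> convex hull (u ` S)" "side p q w = 0" "p \<in> S'" "q \<in> S'" for w S'
  proof -
    have "w \<in> P" using that(1) hull_mono[of "u ` S" "u ` {1..n}" convex] pq unfolding hull by blast
    then have "w \<in> closed_segment (u p) (u q)" using that pq by (intro line_inter_polygon) auto
    then show ?thesis
      using that(3,4) hull_mono[of "{u p, u q}" "u ` S'" convex] by (auto simp: segment_convex_hull)
  qed
  {
    assume "side p q x \<le> 0"
    have eq: "{y \<in> u ` S. side p q y \<le> 0} = u ` (S \<inter> {p..q})"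
      using pq side_sign_iff(1)[OF pq(1-3)] by blast
    show "x \<in> convex hull (u ` (S \<inter> {p..q}))"
      unfolding eq[symmetric]
    proof (rule convex_hull_halfspace[OF side_segment])
      fix w assume "w \<in> convex hull (u ` S)" "side p q w = 0"
      then show "w \<in> convex hull {y \<in> u ` S. side p q y \<le> 0}"
        unfolding eq by (rule seg) (use pq in auto)
    qed fact+
  next
    assume "side p q x \<ge> 0"
    have eq: "{y \<in> u ` S. - side p q y \<le> 0} = u ` (S - {p<..<q})"
      using pq side_sign_iff(2)[OF pq(1-3)] by auto
    have "- side p q ((1 - t) *\<^sub>R y + t *\<^sub>R z) = (1 - t) * - side p q y + t * - side p q z" for y z t
      unfolding side_segment by simp
    then show "x \<in> convex hull (u ` (S - {p<..<q}))"
      unfolding eq[symmetric]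
    proof (rule convex_hull_halfspace)
      fix w assume "w \<in> convex hull (u ` S)" "- side p q w = 0"
      then have "w \<in> convex hull (u ` S)" "side p q w = 0" by auto
      then show "w \<in> convex hull {y \<in> u ` S. - side p q y \<le> 0}"
        unfolding eq by (rule seg) (use pq in auto)
    next
      show "- side p q x \<le> 0" using \<open>side p q x \<ge> 0\<close> by simp
    qed fact
  }
qed

lemma split_polygon:
  assumes "1 \<le> i" "i < j" "j < k" "k \<le> n" and x: "x \<in> convex hull (u ` {i..k})"
  shows "x \<in> convex hull (u ` {i, j, k}) \<or> x \<in> convex hull (u ` {i..j}) \<or> x \<in> convex hull (u ` {j..k})"
proof (cases "side i j x \<le> 0")
  case True
  have eq: "{i..k} \<inter> {i..j} = {i..j}" using assms by auto
  have "x \<in> convex hull (u ` ({i..k} \<inter> {i..j}))"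
    using assms by (intro half_polygon(1)[OF _ _ _ _ _ _ x True]) auto
  then show ?thesis unfolding eq by blast
next
  case False
  let ?S = "{i..k} - {i<..<j}"
  have x': "x \<in> convex hull (u ` ?S)"
    using assms False by (intro half_polygon(2)[OF _ _ _ _ _ _ x]) auto
  show ?thesis
  proof (cases "side j k x \<le> 0")
    case True
    have eq: "?S \<inter> {j..k} = {j..k}" using assms by auto
    have "x \<in> convex hull (u ` (?S \<inter> {j..k}))"
      using assms by (intro half_polygon(1)[OF _ _ _ _ _ _ x' True]) auto
    then show ?thesis unfolding eq by blast
  next
    case False
    have eq: "?S - {j<..<k} = {i, j, k}" using assms by auto
    have "x \<in> convex hull (u ` (?S - {j<..<k}))"
      using assms False by (intro half_polygon(2)[OF _ _ _ _ _ _ x']) auto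
    then show ?thesis unfolding eq by blast
  qed
qed

end

section \<open>Noncrossing families of maximal size\<close>

text \<open>A chord is stored as the pair of its ends, smaller index first. Two distinct chords of a
  convex polygon have a common inner point exactly if their ends interleave.\<close>

definition noncrossing :: "(nat \<times> nat) set \<Rightarrow> bool" where
  "noncrossing E \<longleftrightarrow> (\<forall>(a, b)\<in>E. \<forall>(c, d)\<in>E. \<not> (a < c \<and> c < b \<and> b < d))"

text \<open>The chords of the subpolygon with the consecutive vertices \<open>i, \<dots>, k\<close>; the pair \<open>(i, k)\<close>
  is included, although it is an edge of that subpolygon.\<close>

definition subchords :: "(nat \<times> nat) set \<Rightarrow> nat \<Rightarrow> nat \<Rightarrow> (nat \<times> nat) set" where
  "subchords E i k = {(a, b) \<in> E. i \<le> a \<and> b \<le> k}"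

definition linked :: "(nat \<times> nat) set \<Rightarrow> nat \<Rightarrow> nat \<Rightarrow> bool" where
  "linked E a b \<longleftrightarrow> b = Suc a \<or> (a, b) \<in> E"

lemma noncrossingD:
  "noncrossing E \<Longrightarrow> (a, b) \<in> E \<Longrightarrow> (c, d) \<in> E \<Longrightarrow> a < c \<Longrightarrow> c < b \<Longrightarrow> d \<le> b"
  by (fastforce simp: noncrossing_def)

lemma linked_nested:
  assumes "noncrossing E" "linked E a b" "linked E x y" "a < x" "x < b"
  shows "y \<le> b"
  using assms by (auto simp: linked_def dest: noncrossingD)

lemma finite_subchords:
  assumes "\<And>a b. (a, b) \<in> E \<Longrightarrow> a + 2 \<le> b"
  shows "finite (subchords E i k)"
proof (rule finite_subset)
  show "subchords E i k \<subseteq> {i..k} \<times> {i..k}" using assms by (fastforce simp: subchords_def)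
qed simp

text \<open>The split point \<open>j\<close> is the largest index below \<open>k\<close> that is joined to \<open>i\<close> by a chord
  or an edge. A chord that straddled \<open>j\<close> would start at \<open>i\<close>, against maximality, or
  cross the chord from \<open>i\<close> to \<open>j\<close>.\<close>

lemma subchords_split:
  assumes nc: "noncrossing E" and "i + 2 \<le> k"
  obtains j where "i < j" "j < k" "subchords E i k \<subseteq> insert (i, k) (subchords E i j \<union> subchords E j k)"
proof -
  define B where "B = {j. i < j \<and> j < k \<and> linked E i j}"
  define j where "j = Max B"
  have "finite B" by (rule finite_subset[of _ "{..k}"]) (auto simp: B_def)
  moreover have "Suc i \<in> B" using assms by (auto simp: B_def linked_def)
  ultimately have jB: "j \<in> B" and max: "\<And>b. b \<in> B \<Longrightarrow> b \<le> j"
    unfolding j_def by (auto intro: Max_in)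
  have sub: "(a, b) \<in> subchords E i j \<union> subchords E j k" if ab: "(a, b) \<in> subchords E i k" "(a, b) \<noteq> (i, k)" for a b
  proof -
    have E: "(a, b) \<in> E" "i \<le> a" "b \<le> k" using ab by (auto simp: subchords_def)
    consider "a = i" "b \<le> j" | "i < a" "a < j" | "j \<le> a"
    proof (cases "a = i")
      case True
      have "b \<le> j"
      proof (cases "i < b")
        case True
        with \<open>a = i\<close> ab E have "b \<in> B" by (auto simp: B_def linked_def)
        then show ?thesis by (rule max)
      next
        case False
        then show ?thesis using jB by (auto simp: B_def)
      qed
      with True show ?thesis using that by blast
    qed (use E that in force)
    then show ?thesis
    proof cases
      case 2
      then have "b \<le> j" using linked_nested[OF nc, of i j a b] jB E by (auto simp: B_def linked_def)
      then show ?thesis using E by (simp add: subchords_def)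
    qed (use E in \<open>auto simp: subchords_def\<close>)
  qed
  have "subchords E i k \<subseteq> insert (i, k) (subchords E i j \<union> subchords E j k)"
    by (rule subrelI) (use sub in blast)
  then show ?thesis using that[of j] jB unfolding B_def by blast
qed

text \<open>By recursion over the split, a subpolygon with \<open>m\<close> vertices has at most \<open>m - 2\<close> noncrossing
  chords, the edge \<open>(i, k)\<close> included.\<close>

lemma card_subchords_le:
  assumes nc: "noncrossing E" and long: "\<And>a b. (a, b) \<in> E \<Longrightarrow> a + 2 \<le> b"
  shows "i < k \<Longrightarrow> card (subchords E i k) \<le> k - i - 1"
proof (induction "k - i" arbitrary: i k rule: less_induct)
  case less
  show ?case
  proof (cases "i + 2 \<le> k")
    case True
    then obtain j where j: "i < j" "j < k"
      and sub: "subchords E i k \<subseteq> insert (i, k) (subchords E i j \<union> subchords E j k)"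
      using subchords_split[OF nc] by blast
    have fin: "finite (subchords E i' k')" for i' k' using long by (rule finite_subchords)
    have "card (subchords E i k) \<le> card (insert (i, k) (subchords E i j \<union> subchords E j k))"
      using fin by (intro card_mono sub) auto
    also have "\<dots> \<le> Suc (card (subchords E i j \<union> subchords E j k))"
      using fin by (simp add: card_insert_if)
    also have "\<dots> \<le> Suc (card (subchords E i j) + card (subchords E j k))"
      by (simp add: card_Un_le)
    also have "\<dots> \<le> Suc ((j - i - 1) + (k - j - 1))"
    proof -
      have "card (subchords E i j) \<le> j - i - 1" using less.hyps[of j i] j by auto
      moreover have "card (subchords E j k) \<le> k - j - 1" using less.hyps[of k j] j by auto
      ultimately show ?thesis by linarith
    qed
    finally show ?thesis using j by linarith
  next
    case False
    have "subchords E i k = {}" using long False by (fastforce simp: subchords_def)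
    then show ?thesis by simp
  qed
qed

text \<open>Equality in this bound forces the presence of \<open>(i, k)\<close> and equality in both parts.
  So a noncrossing family of maximal size yields the triangle \<open>i, j, k\<close> and two smaller
  instances of the same situation.\<close>

lemma tight_split:
  assumes nc: "noncrossing E" and long: "\<And>a b. (a, b) \<in> E \<Longrightarrow> a + 2 \<le> b"
    and ik: "i + 2 \<le> k" and tight: "card (subchords E i k) = k - i - 1"
  obtains j where "(i, k) \<in> E" "i < j" "j < k"
    "card (subchords E i j) = j - i - 1" "card (subchords E j k) = k - j - 1"
proof -
  obtain j where j: "i < j" "j < k"
    and sub: "subchords E i k \<subseteq> insert (i, k) (subchords E i j \<union> subchords E j k)"
    using subchords_split[OF nc ik] by blast
  have fin: "finite (subchords E i' k')" for i' k' using long by (rule finite_subchords)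
  have le: "card (subchords E i j) \<le> j - i - 1" "card (subchords E j k) \<le> k - j - 1"
    using card_subchords_le[OF nc long] j by auto
  have Un: "card (subchords E i j \<union> subchords E j k) \<le> card (subchords E i j) + card (subchords E j k)"
    by (rule card_Un_le)
  have "(i, k) \<in> E"
  proof (rule ccontr)
    assume "(i, k) \<notin> E"
    then have "subchords E i k \<subseteq> subchords E i j \<union> subchords E j k" using sub by (auto simp: subchords_def)
    then have "card (subchords E i k) \<le> card (subchords E i j \<union> subchords E j k)"
      using fin by (intro card_mono) auto
    then show False using Un le tight j by linarith
  qed
  moreover have "card (subchords E i k) \<le> Suc (card (subchords E i j \<union> subchords E j k))"
  proof -
    have "card (subchords E i k) \<le> card (insert (i, k) (subchords E i j \<union> subchords E j k))"
      using fin by (intro card_mono sub) auto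
    then show ?thesis using fin by (simp add: card_insert_if split: if_splits)
  qed
  then have "card (subchords E i j) = j - i - 1" "card (subchords E j k) = k - j - 1"
    using Un le tight j by linarith+
  ultimately show ?thesis using that j by blast
qed

section \<open>The triangulation cut out by a noncrossing family\<close>

text \<open>The hypothesis on \<open>E\<close> involves indices only. It is therefore the same for all
  relabellings of the polygon.\<close>

locale triangulated_listing = convex_listing +
  fixes E :: "(nat \<times> nat) set"
  assumes chord_range: "(a, b) \<in> E \<Longrightarrow> 1 \<le> a \<and> a + 2 \<le> b \<and> b \<le> n \<and> (a, b) \<noteq> (1, n)"
    and chords_noncrossing: "noncrossing E"
    and card_chords: "card E = n - 3"
begin

text \<open>With the edge from \<open>1\<close> to \<open>n\<close> added, the whole polygon looks like any of the subpolygons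
  that arise by splitting, and the count is tight for it.\<close>

definition rooted :: "(nat \<times> nat) set" where
  "rooted = insert (1, n) E"

lemma rooted_range: "(a, b) \<in> rooted \<Longrightarrow> 1 \<le> a \<and> a + 2 \<le> b \<and> b \<le> n"
  using chord_range n_ge_3 by (auto simp: rooted_def)

lemma rooted_noncrossing: "noncrossing rooted"
  unfolding noncrossing_def
proof (clarify)
  fix a b c d assume "(a, b) \<in> rooted" "(c, d) \<in> rooted" "a < c" "c < b" "b < d"
  then show False
    using noncrossingD[OF chords_noncrossing, of a b c d] chord_range[of a b] chord_range[of c d]
    by (auto simp: rooted_def)
qed

lemma rooted_tight: "card (subchords rooted 1 n) = n - 1 - 1"
proof -
  have "subchords rooted 1 n = rooted" using rooted_range by (fastforce simp: subchords_def)
  moreover have "finite E"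
    using finite_subset[of E "{1..n} \<times> {1..n}"] chord_range by fastforce
  moreover have "(1, n) \<notin> E" using chord_range by blast
  ultimately show ?thesis using card_chords n_ge_3 by (simp add: rooted_def)
qed

definition triangles :: "nat set set" where
  "triangles = {{a, b, c} | a b c. 1 \<le> a \<and> a < b \<and> b < c \<and> c \<le> n \<and>
     linked rooted a b \<and> linked rooted b c \<and> linked rooted a c}"

lemma triangle_subset: "\<tau> \<in> triangles \<Longrightarrow> \<tau> \<subseteq> {1..n}"
  by (auto simp: triangles_def)

lemma card_triangle: "\<tau> \<in> triangles \<Longrightarrow> card \<tau> = 3"
  by (auto simp: triangles_def)

lemma finite_triangles: "finite triangles"
  using triangle_subset by (intro finite_subset[of triangles "Pow {1..n}"]) auto

text \<open>The triangle \<open>i, j, k\<close> and the two subpolygons on its sides cover the subpolygon, and the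
  tightness is inherited by both of them.\<close>

lemma interval_covered:
  assumes "1 \<le> i" "i + 2 \<le> k" "k \<le> n" "card (subchords rooted i k) = k - i - 1"
    and "x \<in> convex hull (u ` {i..k})"
  shows "\<exists>\<tau>\<in>triangles. x \<in> convex hull (u ` \<tau>)"
  using assms
proof (induction "k - i" arbitrary: i k rule: less_induct)
  case less
  have long: "\<And>a b. (a, b) \<in> rooted \<Longrightarrow> a + 2 \<le> b" using rooted_range by blast
  obtain j where j: "(i, k) \<in> rooted" "i < j" "j < k"
    and tight: "card (subchords rooted i j) = j - i - 1" "card (subchords rooted j k) = k - j - 1"
    using tight_split[OF rooted_noncrossing long] less.prems by blast
  have linked: "linked rooted a b" if "a < b" "card (subchords rooted a b) = b - a - 1" for a b
  proof (cases "b = Suc a")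
    case False
    then show ?thesis
      using that tight_split[OF rooted_noncrossing long, of a b] by (force simp: linked_def)
  qed (simp add: linked_def)
  have T: "{i, j, k} \<in> triangles"
    unfolding triangles_def using j linked tight less.prems
    by (intro CollectI exI[of _ i] exI[of _ j] exI[of _ k]) (auto simp: linked_def)
  consider "x \<in> convex hull (u ` {i, j, k})" | "x \<in> convex hull (u ` {i..j})"
    | "x \<in> convex hull (u ` {j..k})"
    using split_polygon[of i j k x] less.prems j by auto
  then show ?case
  proof cases
    case 1
    then show ?thesis using T by blast
  next
    case 2
    show ?thesis
    proof (cases "j = Suc i")
      case True
      then have "{i..j} \<subseteq> {i, j, k}" by auto
      then have "convex hull (u ` {i..j}) \<subseteq> convex hull (u ` {i, j, k})"
        by (intro hull_mono image_mono)
      then show ?thesis using 2 T by blast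
    next
      case False
      then show ?thesis using less.hyps[of j i] less.prems tight(1) j 2 by auto
    qed
  next
    case 3
    show ?thesis
    proof (cases "k = Suc j")
      case True
      then have "{j..k} \<subseteq> {i, j, k}" by auto
      then have "convex hull (u ` {j..k}) \<subseteq> convex hull (u ` {i, j, k})"
        by (intro hull_mono image_mono)
      then show ?thesis using 3 T by blast
    next
      case False
      then show ?thesis using less.hyps[of k j] less.prems tight(2) j 3 by auto
    qed
  qed
qed

lemma triangles_cover: "P = (\<Union>\<tau>\<in>triangles. convex hull (u ` \<tau>))"
proof
  show "P \<subseteq> (\<Union>\<tau>\<in>triangles. convex hull (u ` \<tau>))"
    using interval_covered[of 1 n] rooted_tight n_ge_3 unfolding hull by auto
  show "(\<Union>\<tau>\<in>triangles. convex hull (u ` \<tau>)) \<subseteq> P"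
    unfolding hull using triangle_subset by (intro UN_least hull_mono image_mono)
qed

text \<open>The corners of a triangle divide the boundary of the polygon into three arcs. The edge below
  an arc separates the triangle from all vertices on that arc.\<close>

lemma arc_separated:
  assumes "1 \<le> a" "a < b" "b < c" "c \<le> n" and S: "S \<subseteq> {1..n}"
    and "S \<subseteq> {a..b} \<or> S \<subseteq> {b..c} \<or> S \<inter> {a<..<c} = {}"
  shows "separated a b S {a, b, c} \<or> separated b c S {a, b, c} \<or> separated a c {a, b, c} S"
  using assms unfolding separated_def by auto

text \<open>An end of the chord strictly inside an arc keeps the other end on that arc, because the chord
  cannot cross the edge below it. For the same reason a chord from a
  corner cannot end strictly inside the opposite arc.\<close>

lemma linked_in_arc:
  assumes "linked rooted a b" "linked rooted b c" "linked rooted a c" "linked rooted p q"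
    and "a < b" "b < c" "p < q"
  shows "a \<le> p \<and> q \<le> b \<or> b \<le> p \<and> q \<le> c \<or> \<not> (a < p \<and> p < c) \<and> \<not> (a < q \<and> q < c)"
proof -
  note nested = linked_nested[OF rooted_noncrossing]
  consider "p < a" | "p = a" | "a < p" "p < b" | "b \<le> p" "p < c" | "c \<le> p" by linarith
  then show ?thesis
  proof cases
    case 1
    then show ?thesis using nested[of p q a c] assms by linarith
  next
    case 2
    then show ?thesis using nested[of p q b c] assms by linarith
  next
    case 3
    then show ?thesis using nested[of a b p q] assms by linarith
  next
    case 4
    then show ?thesis using nested[of a c p q] assms by linarith
  next
    case 5
    then show ?thesis using assms by linarith
  qed
qed

lemma chord_separated:
  assumes "\<tau> \<in> triangles" "(p, q) \<in> E"
  obtains p' q' where "separated p' q' {p, q} \<tau> \<or> separated p' q' \<tau> {p, q}"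
proof -
  obtain a b c where \<tau>: "\<tau> = {a, b, c}" and abc: "1 \<le> a" "a < b" "b < c" "c \<le> n"
    "linked rooted a b" "linked rooted b c" "linked rooted a c"
    using assms by (auto simp: triangles_def)
  have pq: "1 \<le> p" "p < q" "q \<le> n" "linked rooted p q"
    using chord_range[of p q] assms by (auto simp: linked_def rooted_def)
  have "{p, q} \<subseteq> {a..b} \<or> {p, q} \<subseteq> {b..c} \<or> {p, q} \<inter> {a<..<c} = {}"
    using linked_in_arc[of a b c p q] abc pq by auto
  then show ?thesis
    using arc_separated[of a b c "{p, q}"] abc pq that unfolding \<tau> by auto
qed

text \<open>All three edges of \<open>\<sigma>\<close> stay within one arc of \<open>\<tau>\<close> each. Unless the triangles are equal, one
  arc contains all of \<open>\<sigma>\<close>. The edge below that arc is a chord of \<open>E\<close>, because a boundary edge has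
  only two vertices on its far side, namely its ends.\<close>

lemma triangles_separated:
  assumes "\<tau> \<in> triangles" "\<sigma> \<in> triangles" "\<tau> \<noteq> \<sigma>"
  obtains p q where "(p, q) \<in> E" "separated p q \<sigma> \<tau> \<or> separated p q \<tau> \<sigma>"
proof -
  obtain a b c where \<tau>: "\<tau> = {a, b, c}" and abc: "1 \<le> a" "a < b" "b < c" "c \<le> n"
    and links: "linked rooted a b" "linked rooted b c" "linked rooted a c"
    using assms by (auto simp: triangles_def)
  obtain x y z where \<sigma>: "\<sigma> = {x, y, z}" and xyz: "1 \<le> x" "x < y" "y < z" "z \<le> n"
    "linked rooted x y" "linked rooted y z" "linked rooted x z"
    using assms by (auto simp: triangles_def)
  have ne: "\<not> (x = a \<and> y = b \<and> z = c)" using assms(3) \<tau> \<sigma> by auto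
  note arc = linked_in_arc[OF links _ abc(2,3)]
  have arcs: "a \<le> x \<and> y \<le> b \<or> b \<le> x \<and> y \<le> c \<or> \<not> (a < x \<and> x < c) \<and> \<not> (a < y \<and> y < c)"
    "a \<le> y \<and> z \<le> b \<or> b \<le> y \<and> z \<le> c \<or> \<not> (a < y \<and> y < c) \<and> \<not> (a < z \<and> z < c)"
    "a \<le> x \<and> z \<le> b \<or> b \<le> x \<and> z \<le> c \<or> \<not> (a < x \<and> x < c) \<and> \<not> (a < z \<and> z < c)"
    using arc xyz by auto
  consider "x \<le> a" "y = b" "c \<le> z" | "a < x" "x < c" | "a < y" "y < c" "y \<noteq> b" | "a < z" "z < c"
    | "\<not> (a < x \<and> x < c) \<and> \<not> (a < y \<and> y < c) \<and> \<not> (a < z \<and> z < c)"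
    using abc xyz by linarith
  then have "a \<le> x \<and> z \<le> b \<or> b \<le> x \<and> z \<le> c \<or>
      \<not> (a < x \<and> x < c) \<and> \<not> (a < y \<and> y < c) \<and> \<not> (a < z \<and> z < c)"
  proof cases
    case 1
    then show ?thesis using arcs(1,2) abc ne by linarith
  qed (use arcs abc xyz in linarith)+
  then have "\<sigma> \<subseteq> {a..b} \<or> \<sigma> \<subseteq> {b..c} \<or> \<sigma> \<inter> {a<..<c} = {}"
    unfolding \<sigma> using xyz by auto
  then have sep: "separated a b \<sigma> \<tau> \<or> separated b c \<sigma> \<tau> \<or> separated a c \<tau> \<sigma>"
    using arc_separated[OF abc triangle_subset[OF assms(2)]] unfolding \<tau> by blast
  \<comment> \<open>One side of a boundary edge has no room for the three vertices of a triangle.\<close>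
  have edge: "(p, q) \<in> E"
    if "linked rooted p q" "separated p q S S'" "card S = 3" "card S' = 3" for p q S S'
  proof -
    have "S \<subseteq> {p..q}" "S' \<subseteq> {1..n} - {p<..<q}" using that by (auto simp: separated_def)
    then have "card S \<le> card {p..q}" "card S' \<le> card ({1..n} - {p<..<q})"
      by (intro card_mono; simp)+
    then have q: "q \<noteq> Suc p" and "card ({1..n} - {p<..<q}) \<ge> 3"
      using that by auto
    moreover have "{1..n} - {1<..<n} = {1, n}" using n_ge_3 by auto
    ultimately have "(p, q) \<noteq> (1, n)" using n_ge_3 by auto
    then show ?thesis using that(1) q by (auto simp: linked_def rooted_def)
  qed
  show ?thesis
    using sep edge links that card_triangle[OF assms(1)] card_triangle[OF assms(2)] by metis
qed

text \<open>Different triangles are separated by a chord, and on a chord the weights are unique. It follows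
  that areal coordinates agree wherever triangles overlap, and that the weight of a
  vertex is zero as soon as one triangle containing the point lacks that vertex.\<close>

lemma bary_agree:
  assumes "\<tau> \<in> triangles" "\<sigma> \<in> triangles" "bary \<alpha> \<tau> x" "bary \<beta> \<sigma> x"
  shows "\<alpha> = \<beta>"
proof (cases "\<tau> = \<sigma>")
  case True
  then obtain a b c where "\<tau> = {a, b, c}" "1 \<le> a" "a < b" "b < c" "c \<le> n"
    using assms by (auto simp: triangles_def)
  then show ?thesis using bary_triangle_unique[of a b c \<alpha> x \<beta>] assms True by auto
next
  case False
  then obtain p q where "separated p q \<sigma> \<tau> \<or> separated p q \<tau> \<sigma>"
    using triangles_separated assms by metis
  then show ?thesis using bary_separated(1) assms by metis
qed

lemma in_chord_iff_bary:
  assumes "(p, q) \<in> E"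
  shows "x \<in> closed_segment (u p) (u q) \<longleftrightarrow> (\<exists>\<beta>. bary \<beta> {p, q} x)"
  using in_hull_iff_bary[of "{p, q}" x] chord_range[OF assms] by (simp add: segment_convex_hull)

lemma bary_on_chord:
  assumes "\<tau> \<in> triangles" "(p, q) \<in> E" "bary \<alpha> \<tau> x"
  shows "x \<in> closed_segment (u p) (u q) \<longleftrightarrow> (\<forall>m. m \<notin> {p, q} \<longrightarrow> \<alpha> m = 0)"
proof
  assume "x \<in> closed_segment (u p) (u q)"
  then obtain \<beta> where \<beta>: "bary \<beta> {p, q} x" using in_chord_iff_bary assms by blast
  obtain p' q' where "separated p' q' {p, q} \<tau> \<or> separated p' q' \<tau> {p, q}"
    using chord_separated assms by metis
  then have "\<alpha> = \<beta>" using bary_separated(1) \<beta> assms by metis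
  then show "\<forall>m. m \<notin> {p, q} \<longrightarrow> \<alpha> m = 0" using \<beta> by (simp add: bary_def)
next
  assume "\<forall>m. m \<notin> {p, q} \<longrightarrow> \<alpha> m = 0"
  then have "bary \<alpha> {p, q} x" using assms(3) by (simp add: bary_def)
  then show "x \<in> closed_segment (u p) (u q)" using in_chord_iff_bary assms by blast
qed

definition chord_segments :: "point set set" where
  "chord_segments = {closed_segment (u a) (u b) | a b. (a, b) \<in> E}"

text \<open>The components of the polygon without its chords, as \<open>pieces_eq\<close> will show.\<close>

definition cell :: "nat set \<Rightarrow> point set" where
  "cell \<tau> = convex hull (u ` \<tau>) - \<Union>chord_segments"

lemma cell_iff_bary:
  assumes "\<tau> \<in> triangles" "bary \<alpha> \<tau> x"
  shows "x \<in> cell \<tau> \<longleftrightarrow> (\<forall>(p, q)\<in>E. \<exists>m. m \<notin> {p, q} \<and> \<alpha> m \<noteq> 0)"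
proof -
  have "x \<in> convex hull (u ` \<tau>)" using in_hull_iff_bary[OF triangle_subset] assms by blast
  moreover have "x \<in> \<Union>chord_segments \<longleftrightarrow> (\<exists>(p, q)\<in>E. x \<in> closed_segment (u p) (u q))"
    by (auto simp: chord_segments_def)
  moreover have "\<dots> \<longleftrightarrow> (\<exists>(p, q)\<in>E. \<forall>m. m \<notin> {p, q} \<longrightarrow> \<alpha> m = 0)"
    using bary_on_chord[OF assms(1) _ assms(2)] by (intro bex_cong) auto
  ultimately show ?thesis unfolding cell_def by fastforce
qed

lemma bary_convex_combination:
  assumes "bary \<alpha> S x" "bary \<beta> S y" "0 \<le> s" "0 \<le> t" "s + t = 1"
  shows "bary (\<lambda>m. s * \<alpha> m + t * \<beta> m) S (s *\<^sub>R x + t *\<^sub>R y)"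
proof -
  have "(\<Sum>m\<in>{1..n}. s * \<alpha> m + t * \<beta> m) = s * sum \<alpha> {1..n} + t * sum \<beta> {1..n}"
    by (simp add: sum.distrib sum_distrib_left)
  moreover have "(\<Sum>m\<in>{1..n}. (s * \<alpha> m + t * \<beta> m) *\<^sub>R u m)
      = s *\<^sub>R (\<Sum>m\<in>{1..n}. \<alpha> m *\<^sub>R u m) + t *\<^sub>R (\<Sum>m\<in>{1..n}. \<beta> m *\<^sub>R u m)"
    by (simp add: sum.distrib scaleR_sum_right scaleR_add_left)
  ultimately show ?thesis using assms by (simp add: bary_def)
qed

lemma obtain_bary:
  assumes "\<tau> \<in> triangles" "x \<in> convex hull (u ` \<tau>)"
  obtains \<alpha> where "bary \<alpha> \<tau> x"
  using in_hull_iff_bary[OF triangle_subset] assms by blast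

text \<open>The chords meet the triangle in faces: an inner point of a segment lies on a chord only if
  the weights of both ends of the segment are concentrated on that chord.\<close>

lemma convex_cell:
  assumes \<tau>: "\<tau> \<in> triangles" shows "convex (cell \<tau>)"
proof (rule convexI)
  fix x y and s t :: real
  assume xy: "x \<in> cell \<tau>" "y \<in> cell \<tau>" and st: "0 \<le> s" "0 \<le> t" "s + t = 1"
  obtain \<alpha> where \<alpha>: "bary \<alpha> \<tau> x" using obtain_bary[OF \<tau>] xy(1) by (auto simp: cell_def)
  obtain \<beta> where \<beta>: "bary \<beta> \<tau> y" using obtain_bary[OF \<tau>] xy(2) by (auto simp: cell_def)
  note bary = bary_convex_combination[OF \<alpha> \<beta> st]
  have nonneg: "0 \<le> s * \<alpha> m" "0 \<le> t * \<beta> m" for m using \<alpha> \<beta> st by (auto simp: bary_def)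
  have "\<exists>m. m \<notin> {p, q} \<and> s * \<alpha> m + t * \<beta> m \<noteq> 0" if pq: "(p, q) \<in> E" for p q
  proof (cases "s = 0")
    case False
    obtain m where "m \<notin> {p, q}" "\<alpha> m \<noteq> 0"
      using cell_iff_bary[OF \<tau> \<alpha>] xy pq by blast
    then show ?thesis using False nonneg[of m] add_nonneg_eq_0_iff[of "s * \<alpha> m" "t * \<beta> m"] by auto
  next
    case True
    obtain m where "m \<notin> {p, q}" "\<beta> m \<noteq> 0"
      using cell_iff_bary[OF \<tau> \<beta>] xy pq by blast
    then show ?thesis using True st by auto
  qed
  then show "s *\<^sub>R x + t *\<^sub>R y \<in> cell \<tau>" unfolding cell_iff_bary[OF \<tau> bary] by blast
qed

lemma positive_in_cell:
  assumes \<tau>: "\<tau> \<in> triangles" and \<alpha>: "bary \<alpha> \<tau> x" and pos: "\<And>m. m \<in> \<tau> \<Longrightarrow> \<alpha> m > 0"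
  shows "x \<in> cell \<tau>"
  unfolding cell_iff_bary[OF \<tau> \<alpha>]
proof clarify
  fix p q assume "(p, q) \<in> E"
  have "\<not> \<tau> \<subseteq> {p, q}"
  proof
    assume "\<tau> \<subseteq> {p, q}"
    then have "card \<tau> \<le> card {p, q}" by (intro card_mono) auto
    moreover have "card {p, q} \<le> 2" by (simp add: card_insert_if)
    ultimately show False using card_triangle[OF \<tau>] by simp
  qed
  then obtain m where "m \<in> \<tau>" "m \<notin> {p, q}" by blast
  then show "\<exists>m. m \<notin> {p, q} \<and> \<alpha> m \<noteq> 0" using pos[of m] by (intro exI[of _ m]) auto
qed

lemma obtain_centre:
  assumes \<tau>: "\<tau> \<in> triangles"
  obtains \<gamma> z where "bary \<gamma> \<tau> z" "\<And>m. m \<in> \<tau> \<Longrightarrow> \<gamma> m > 0"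
proof -
  define \<gamma> :: "nat \<Rightarrow> real" where "\<gamma> m = (if m \<in> \<tau> then 1/3 else 0)" for m
  have "sum \<gamma> {1..n} = sum \<gamma> \<tau>"
    by (rule sum.mono_neutral_right) (use triangle_subset[OF \<tau>] in \<open>auto simp: \<gamma>_def\<close>)
  also have "\<dots> = 1" using card_triangle[OF \<tau>] by (simp add: \<gamma>_def)
  finally have "bary \<gamma> \<tau> (\<Sum>m\<in>{1..n}. \<gamma> m *\<^sub>R u m)" by (simp add: bary_def \<gamma>_def)
  then show ?thesis using that by (auto simp: \<gamma>_def)
qed

text \<open>On the way from any point of the triangle to its centre all weights are positive from the
  first moment on, which keeps the way off the chords.\<close>

lemma closure_cell:
  assumes \<tau>: "\<tau> \<in> triangles" shows "closure (cell \<tau>) = convex hull (u ` \<tau>)"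
proof
  have "finite \<tau>" using finite_subset[OF triangle_subset[OF \<tau>]] by simp
  then have "closed (convex hull (u ` \<tau>))"
    by (intro compact_imp_closed finite_imp_compact_convex_hull) simp
  then show "closure (cell \<tau>) \<subseteq> convex hull (u ` \<tau>)"
    by (intro closure_minimal) (auto simp: cell_def)
  show "convex hull (u ` \<tau>) \<subseteq> closure (cell \<tau>)"
  proof
    fix x assume "x \<in> convex hull (u ` \<tau>)"
    then obtain \<alpha> where \<alpha>: "bary \<alpha> \<tau> x" using obtain_bary[OF \<tau>] by blast
    obtain \<gamma> z where \<gamma>: "bary \<gamma> \<tau> z" and pos: "\<And>m. m \<in> \<tau> \<Longrightarrow> \<gamma> m > 0"
      using obtain_centre[OF \<tau>] by blast
    have z: "z \<in> cell \<tau>" using positive_in_cell[OF \<tau> \<gamma> pos] .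
    show "x \<in> closure (cell \<tau>)"
    proof (cases "x = z")
      case True
      then show ?thesis using z closure_subset by blast
    next
      case False
      have "open_segment x z \<subseteq> cell \<tau>"
      proof
        fix y assume "y \<in> open_segment x z"
        then obtain t where t: "0 < t" "t < 1" "y = (1 - t) *\<^sub>R x + t *\<^sub>R z"
          by (auto simp: in_segment)
        then have "bary (\<lambda>m. (1 - t) * \<alpha> m + t * \<gamma> m) \<tau> y"
          using bary_convex_combination[OF \<alpha> \<gamma>, of "1 - t" t] by simp
        then show "y \<in> cell \<tau>"
        proof (rule positive_in_cell[OF \<tau>])
          fix m assume "m \<in> \<tau>"
          then have "0 < t * \<gamma> m" using t pos by simp
          moreover have "0 \<le> (1 - t) * \<alpha> m" using t \<alpha> by (simp add: bary_def)
          ultimately show "0 < (1 - t) * \<alpha> m + t * \<gamma> m" by linarith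
        qed
      qed
      then have "closure (open_segment x z) \<subseteq> closure (cell \<tau>)" by (rule closure_mono)
      then show ?thesis using False by auto
    qed
  qed
qed

lemma cells_disjoint:
  assumes "\<tau> \<in> triangles" "\<sigma> \<in> triangles" "\<tau> \<noteq> \<sigma>"
  shows "cell \<tau> \<inter> cell \<sigma> = {}"
proof -
  have False if x: "x \<in> cell \<tau>" "x \<in> cell \<sigma>" for x
  proof -
    obtain \<alpha> where \<alpha>: "bary \<alpha> \<tau> x" using obtain_bary assms x by (auto simp: cell_def)
    obtain \<beta> where \<beta>: "bary \<beta> \<sigma> x" using obtain_bary assms x by (auto simp: cell_def)
    obtain p q where pq: "(p, q) \<in> E" "separated p q \<sigma> \<tau> \<or> separated p q \<tau> \<sigma>"
      using triangles_separated[OF assms] by blast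
    then have "\<alpha> m = 0" if "m \<notin> {p, q}" for m
      using bary_separated[of p q \<sigma> \<tau> \<beta> x \<alpha>] bary_separated(2)[of p q \<tau> \<sigma> \<alpha> x \<beta> m] \<alpha> \<beta> that
      by auto
    then show False using cell_iff_bary[OF assms(1) \<alpha>] x(1) pq(1) by blast
  qed
  then show ?thesis by blast
qed

lemma pieces_eq: "pieces P chord_segments = (\<lambda>\<tau>. convex hull (u ` \<tau>)) ` triangles"
proof -
  let ?X = "P - \<Union>chord_segments"
  have "components ?X = cell ` triangles"
  proof (rule components_of_closed_partition)
    show "finite (cell ` triangles)" using finite_triangles by simp
    show "\<Union>(cell ` triangles) = ?X" unfolding triangles_cover by (auto simp: cell_def)
    show "pairwise disjnt (cell ` triangles)"
      using cells_disjoint by (auto simp: pairwise_def disjnt_def)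
  next
    fix C assume "C \<in> cell ` triangles"
    then obtain \<tau> where \<tau>: "\<tau> \<in> triangles" "C = cell \<tau>" by blast
    have "C = ?X \<inter> convex hull (u ` \<tau>)"
      using \<tau> unfolding triangles_cover by (auto simp: cell_def)
    moreover have "closed (convex hull (u ` \<tau>))"
      using closure_cell[OF \<tau>(1)] by (metis closed_closure)
    ultimately show "closedin (top_of_set ?X) C" by (auto simp: closedin_closed)
    obtain \<gamma> z where "bary \<gamma> \<tau> z" "\<And>m. m \<in> \<tau> \<Longrightarrow> \<gamma> m > 0"
      using obtain_centre[OF \<tau>(1)] by blast
    then have "z \<in> C" using positive_in_cell \<tau> by blast
    then show "connected C \<and> C \<noteq> {}" using convex_cell[OF \<tau>(1)] convex_connected \<tau>(2) by auto
  qed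
  then show ?thesis
    using closure_cell by (auto simp: pieces_def image_image intro!: image_cong)
qed

lemma areal_eq_bary:
  assumes "\<sigma> \<in> triangles" "m \<in> \<sigma>" and \<beta>: "bary \<beta> \<sigma> x"
  shows "areal (convex hull (u ` \<sigma>)) (u m) x = \<beta> m"
proof -
  have main: "areal (convex hull {u a, u b, u c}) (u b) x = \<beta> b"
    if abc: "\<sigma> = {a, b, c}" "a \<noteq> b" "b \<noteq> c" "a \<noteq> c" for a b c
  proof -
    have sub: "{a, b, c} \<subseteq> {1..n}" using triangle_subset assms(1) abc by blast
    have "sum \<beta> {1..n} = sum \<beta> {a, b, c}" "(\<Sum>m\<in>{1..n}. \<beta> m *\<^sub>R u m) = (\<Sum>m\<in>{a, b, c}. \<beta> m *\<^sub>R u m)"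
      by (rule sum.mono_neutral_right; use sub \<beta> abc in \<open>auto simp: bary_def\<close>)+
    then have "\<beta> a + \<beta> b + \<beta> c = 1" "x = \<beta> a *\<^sub>R u a + \<beta> b *\<^sub>R u b + \<beta> c *\<^sub>R u c"
      using \<beta> abc by (auto simp: bary_def add_ac)
    moreover have "signed_area (u a) (u b) (u c) \<noteq> 0"
      using side_nonzero[OF sub] abc by (auto simp: side_def)
    ultimately show ?thesis using areal_barycentric by blast
  qed
  obtain a b c where abc: "\<sigma> = {a, b, c}" "a < b" "b < c" using assms by (auto simp: triangles_def)
  then consider "m = a" | "m = b" | "m = c" using assms by auto
  then show ?thesis
  proof cases
    case 1
    then show ?thesis using main[of b a c] abc by (simp add: insert_commute)
  next
    case 2
    then show ?thesis using main[of a b c] abc by simp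
  next
    case 3
    then show ?thesis using main[of a c b] abc by (simp add: insert_commute)
  qed
qed

text \<open>If \<open>x\<close> lies in some triangle at the vertex \<open>m\<close>, the value is the weight of \<open>m\<close> there, which
  equals \<open>\<alpha> m\<close> because weights agree across triangles. Otherwise \<open>m\<close> is no corner of \<open>\<tau>\<close>, and both
  sides are zero.\<close>

lemma chordal_coord_eq_bary:
  assumes \<tau>: "\<tau> \<in> triangles" and \<alpha>: "bary \<alpha> \<tau> x" and m: "m \<in> {1..n}"
  shows "chordal_coord P chord_segments (u m) x = \<alpha> m"
proof -
  let ?S = "{\<rho> \<in> pieces P chord_segments. u m \<in> \<rho>}"
  have S: "?S = (\<lambda>\<sigma>. convex hull (u ` \<sigma>)) ` {\<sigma> \<in> triangles. m \<in> \<sigma>}"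
    unfolding pieces_eq using vertex_in_hull_iff[OF m triangle_subset] by auto
  have areal: "areal \<rho> (u m) y = \<beta> m"
    if "\<rho> \<in> ?S" "y \<in> \<rho>" "\<tau>' \<in> triangles" "bary \<beta> \<tau>' y" for \<rho> y \<tau>' \<beta>
  proof -
    obtain \<sigma> where \<sigma>: "\<sigma> \<in> triangles" "m \<in> \<sigma>" "\<rho> = convex hull (u ` \<sigma>)"
      using \<open>\<rho> \<in> ?S\<close> unfolding S by blast
    then obtain \<gamma> where \<gamma>: "bary \<gamma> \<sigma> y" using obtain_bary \<open>y \<in> \<rho>\<close> by blast
    then have "\<gamma> = \<beta>" using bary_agree \<sigma> that by blast
    then show ?thesis using areal_eq_bary \<sigma> \<gamma> by blast
  qed
  have fin: "finite ?S" unfolding S using finite_triangles by simp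
  have agree: "areal \<rho> (u m) y = areal \<rho>' (u m) y"
    if \<rho>: "\<rho> \<in> ?S" "\<rho>' \<in> ?S" "y \<in> \<rho>" "y \<in> \<rho>'" for \<rho> \<rho>' y
  proof -
    obtain \<sigma> where \<sigma>: "\<sigma> \<in> triangles" "y \<in> convex hull (u ` \<sigma>)"
      using \<rho>(1,3) unfolding S by blast
    then obtain \<beta> where "bary \<beta> \<sigma> y" using obtain_bary by blast
    then show ?thesis using areal[OF \<rho>(1,3) \<sigma>(1)] areal[OF \<rho>(2,4) \<sigma>(1)] by simp
  qed
  show ?thesis
  proof (cases "x \<in> \<Union>?S")
    case True
    then obtain \<rho> where "\<rho> \<in> ?S" "x \<in> \<rho>" by blast
    then show ?thesis using chordal_coord_values(1)[OF fin agree] areal \<tau> \<alpha> by simp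
  next
    case False
    have "m \<notin> \<tau>"
      using False \<tau> \<alpha> in_hull_iff_bary[OF triangle_subset[OF \<tau>]] unfolding S by blast
    then have "\<alpha> m = 0" using \<alpha> by (simp add: bary_def)
    then show ?thesis using chordal_coord_values(2)[OF fin agree False] by simp
  qed
qed

lemma chordal_coordinate_system:
  "coordinate_system P (u ` {1..n}) (chordal_coord P chord_segments)"
proof -
  have "(\<forall>m\<in>{1..n}. chordal_coord P chord_segments (u m) x \<in> {0..1}) \<and>
      (\<Sum>w\<in>u ` {1..n}. chordal_coord P chord_segments w x) = 1 \<and>
      x = (\<Sum>w\<in>u ` {1..n}. chordal_coord P chord_segments w x *\<^sub>R w)" if xP: "x \<in> P" for x
  proof -
    obtain \<tau> where \<tau>: "\<tau> \<in> triangles" "x \<in> convex hull (u ` \<tau>)"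
      using xP unfolding triangles_cover by blast
    then obtain \<alpha> where \<alpha>: "bary \<alpha> \<tau> x" using obtain_bary by blast
    have coord: "chordal_coord P chord_segments (u m) x = \<alpha> m" if "m \<in> {1..n}" for m
      using chordal_coord_eq_bary[OF \<tau>(1) \<alpha> that] .
    have "\<alpha> m \<le> 1" if "m \<in> {1..n}" for m
      using member_le_sum[of m "{1..n}" \<alpha>] that \<alpha> by (auto simp: bary_def)
    moreover have "(\<Sum>w\<in>u ` {1..n}. chordal_coord P chord_segments w x) = sum \<alpha> {1..n}"
      by (subst sum.reindex[OF inj]) (auto intro!: sum.cong simp: coord)
    moreover have "(\<Sum>w\<in>u ` {1..n}. chordal_coord P chord_segments w x *\<^sub>R w)
        = (\<Sum>m\<in>{1..n}. \<alpha> m *\<^sub>R u m)"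
      by (subst sum.reindex[OF inj]) (auto intro!: sum.cong simp: coord)
    ultimately show ?thesis using \<alpha> coord by (auto simp: bary_def)
  qed
  then show ?thesis unfolding coordinate_system_def by auto
qed

end

section \<open>The dihedral group\<close>

lemma cyclic_succ_eq:
  fixes n i :: nat assumes "i \<in> {1..n}" shows "i mod n + 1 = (if i = n then 1 else i + 1)"
  using assms by auto

lemma cyclic_succ_in:
  fixes n i :: nat assumes "i \<in> {1..n}" shows "i mod n + 1 \<in> {1..n}"
  unfolding cyclic_succ_eq[OF assms] using assms by auto

lemma cyclic_succ_inj:
  fixes n i j :: nat
  assumes "i \<in> {1..n}" "j \<in> {1..n}" "i mod n + 1 = j mod n + 1" shows "i = j"
proof -
  have "(if i = n then 1 else i + 1) = (if j = n then 1 else j + 1)"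
    using assms(3) by (simp only: cyclic_succ_eq[OF assms(1)] cyclic_succ_eq[OF assms(2)])
  then show ?thesis using assms(1,2) by (cases "i = n"; cases "j = n") simp_all
qed

lemma cyclic_succ_twice:
  fixes n i :: nat
  assumes "n \<ge> 3" "i \<in> {1..n}" shows "(i mod n + 1) mod n + 1 \<noteq> i"
proof (cases "i = n")
  case True
  then show ?thesis using assms by simp
next
  case False
  then have "i mod n + 1 = i + 1" using cyclic_succ_eq[OF assms(2)] by simp
  moreover have "(i + 1) mod n + 1 = (if i + 1 = n then 1 else i + 1 + 1)"
    using False assms by (intro cyclic_succ_eq) auto
  ultimately show ?thesis using assms by auto
qed

lemma dihedral_permutes: "g \<in> dihedral n \<Longrightarrow> g permutes {1..n}"
  unfolding dihedral_def by (elim CollectE conjE)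

lemma dihedral_adjacent:
  "g \<in> dihedral n \<Longrightarrow> i \<in> {1..n} \<Longrightarrow> j \<in> {1..n} \<Longrightarrow>
    cycle_adjacent n (g i) (g j) \<longleftrightarrow> cycle_adjacent n i j"
  unfolding dihedral_def by (elim CollectE conjE) (drule (1) bspec, drule (1) bspec)

lemma dihedralI:
  assumes "g permutes {1..n}"
    and "\<And>i j. i \<in> {1..n} \<Longrightarrow> j \<in> {1..n} \<Longrightarrow>
      cycle_adjacent n (g i) (g j) \<longleftrightarrow> cycle_adjacent n i j"
  shows "g \<in> dihedral n"
  unfolding dihedral_def using assms by (intro CollectI conjI ballI)

lemma dihedral_in: "g \<in> dihedral n \<Longrightarrow> i \<in> {1..n} \<Longrightarrow> g i \<in> {1..n}"
  using permutes_in_image[OF dihedral_permutes, of g n i] by (rule iffD2)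

text \<open>An automorphism of the cycle either preserves or reverses the cyclic successor: it sends each
  edge to an edge, and it cannot turn round at a vertex.\<close>

lemma dihedral_orientation:
  assumes n: "n \<ge> 3" and g: "g \<in> dihedral n"
  shows "(\<forall>i\<in>{1..n}. g (i mod n + 1) = g i mod n + 1) \<or>
    (\<forall>i\<in>{1..n}. g i = g (i mod n + 1) mod n + 1)"
proof -
  define s where "s i = i mod n + 1" for i
  have s_in: "s i \<in> {1..n}" if "i \<in> {1..n}" for i using cyclic_succ_in that by (simp add: s_def)
  note g_in = dihedral_in[OF g]
  have g_inj: "g i = g j \<Longrightarrow> i = j" for i j
    using permutes_inj[OF dihedral_permutes[OF g]] by (rule injD)
  have adj: "g (s i) = s (g i) \<or> g i = s (g (s i))" if i: "i \<in> {1..n}" for i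
  proof -
    have "cycle_adjacent n i (s i)" using i s_in by (simp add: cycle_adjacent_def s_def)
    then have "cycle_adjacent n (g i) (g (s i))" using dihedral_adjacent[OF g i s_in[OF i]] by blast
    then show ?thesis by (simp add: cycle_adjacent_def s_def)
  qed
  have s_inj: "i = j" if "i \<in> {1..n}" "j \<in> {1..n}" "s i = s j" for i j
    using cyclic_succ_inj that by (simp add: s_def)
  have twice: "s (s i) \<noteq> i" if "i \<in> {1..n}" for i
    using cyclic_succ_twice[OF n that] by (simp add: s_def)
  \<comment> \<open>A change of direction at a vertex would send both of its neighbours to the same vertex.\<close>
  have turn: "g (s i) = s (g i) \<longleftrightarrow> g (s (s i)) = s (g (s i))" if i: "i \<in> {1..n}" for i
  proof
    assume fwd: "g (s i) = s (g i)"
    show "g (s (s i)) = s (g (s i))"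
    proof (rule ccontr)
      assume "\<not> ?thesis"
      then have "g (s i) = s (g (s (s i)))" using adj[OF s_in[OF i]] by blast
      then have "g i = g (s (s i))" using fwd s_inj g_in s_in i by metis
      then show False using g_inj twice[OF i] by metis
    qed
  next
    assume fwd: "g (s (s i)) = s (g (s i))"
    show "g (s i) = s (g i)"
    proof (rule ccontr)
      assume "\<not> ?thesis"
      then have "g i = s (g (s i))" using adj[OF i] by blast
      then have "g i = g (s (s i))" using fwd by simp
      then show False using g_inj twice[OF i] by metis
    qed
  qed
  have all: "g (s i) = s (g i) \<longleftrightarrow> g (s 1) = s (g 1)" if "i \<in> {1..n}" for i
  proof -
    have "1 \<le> i" using that by simp
    then show ?thesis using that
    proof (induction i rule: dec_induct)
      case (step i)
      then have i: "i \<in> {1..n}" and s_i: "s i = Suc i" by (auto simp: s_def)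
      show ?case using turn[OF i] step.IH[OF i] unfolding s_i by blast
    qed simp
  qed
  show ?thesis
  proof (cases "g (s 1) = s (g 1)")
    case True
    then show ?thesis using all unfolding s_def by blast
  next
    case False
    then have "g i = s (g (s i))" if "i \<in> {1..n}" for i using all adj that by blast
    then show ?thesis unfolding s_def by blast
  qed
qed

lemma dihedral_comp:
  assumes g: "g \<in> dihedral n" and h: "h \<in> dihedral n" shows "g \<circ> h \<in> dihedral n"
  unfolding dihedral_def
proof (intro CollectI conjI ballI)
  show "g \<circ> h permutes {1..n}"
    using permutes_compose[OF dihedral_permutes[OF h] dihedral_permutes[OF g]] .
next
  fix i j assume ij: "i \<in> {1..n}" "j \<in> {1..n}"
  show "cycle_adjacent n ((g \<circ> h) i) ((g \<circ> h) j) \<longleftrightarrow> cycle_adjacent n i j"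
    unfolding comp_apply dihedral_adjacent[OF g dihedral_in[OF h ij(1)] dihedral_in[OF h ij(2)]]
    by (rule dihedral_adjacent[OF h ij])
qed

definition rotation :: "nat \<Rightarrow> nat \<Rightarrow> nat" where
  "rotation n i = (if i \<in> {1..n} then i mod n + 1 else i)"

definition reflection :: "nat \<Rightarrow> nat \<Rightarrow> nat" where
  "reflection n i = (if i \<in> {1..n} then n + 1 - i else i)"

lemma rotation_dihedral: "rotation n \<in> dihedral n"
proof -
  have inj: "inj_on (rotation n) {1..n}"
    using cyclic_succ_inj by (auto simp: inj_on_def rotation_def)
  moreover have "rotation n ` {1..n} \<subseteq> {1..n}" using cyclic_succ_in by (auto simp: rotation_def)
  ultimately have "bij_betw (rotation n) {1..n} {1..n}"
    by (simp add: bij_betw_def endo_inj_surj)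
  then have "rotation n permutes {1..n}" by (rule bij_imp_permutes) (simp only: rotation_def if_False)
  moreover have "cycle_adjacent n (rotation n i) (rotation n j) \<longleftrightarrow> cycle_adjacent n i j"
    if ij: "i \<in> {1..n}" "j \<in> {1..n}" for i j
  proof -
    have r: "rotation n i = i mod n + 1" "rotation n j = j mod n + 1"
      using ij by (simp_all only: rotation_def if_True)
    have "rotation n j = rotation n i mod n + 1 \<longleftrightarrow> j = i mod n + 1"
      unfolding r using cyclic_succ_inj[OF ij(2) cyclic_succ_in[OF ij(1)]] by blast
    moreover have "rotation n i = rotation n j mod n + 1 \<longleftrightarrow> i = j mod n + 1"
      unfolding r using cyclic_succ_inj[OF ij(1) cyclic_succ_in[OF ij(2)]] by blast
    moreover have "rotation n i \<in> {1..n}" "rotation n j \<in> {1..n}"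
      unfolding r using cyclic_succ_in[OF ij(1)] cyclic_succ_in[OF ij(2)] by blast+
    ultimately show ?thesis using ij unfolding cycle_adjacent_def by blast
  qed
  ultimately show ?thesis by (rule dihedralI)
qed

lemma reflection_dihedral: "reflection n \<in> dihedral n"
proof -
  have "inj_on (reflection n) {1..n}" by (auto simp: inj_on_def reflection_def)
  moreover have "reflection n ` {1..n} \<subseteq> {1..n}" by (auto simp: reflection_def)
  ultimately have "bij_betw (reflection n) {1..n} {1..n}"
    by (simp add: bij_betw_def endo_inj_surj)
  then have "reflection n permutes {1..n}" by (rule bij_imp_permutes) (simp only: reflection_def if_False)
  moreover have "cycle_adjacent n (reflection n i) (reflection n j) \<longleftrightarrow> cycle_adjacent n i j"
    if ij: "i \<in> {1..n}" "j \<in> {1..n}" for i j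
  proof -
    have r: "reflection n i \<in> {1..n}" "reflection n j \<in> {1..n}" using ij by (auto simp: reflection_def)
    show ?thesis
      unfolding cycle_adjacent_def cyclic_succ_eq[OF r(1)] cyclic_succ_eq[OF r(2)]
        cyclic_succ_eq[OF ij(1)] cyclic_succ_eq[OF ij(2)]
      using ij r by (auto simp: reflection_def split: if_splits)
  qed
  ultimately show ?thesis by (rule dihedralI)
qed

lemma rotation_power_dihedral: "(rotation n ^^ k) \<in> dihedral n"
proof (induction k)
  case 0
  then show ?case by (simp add: dihedral_def permutes_def)
next
  case (Suc k)
  then show ?case using dihedral_comp[OF rotation_dihedral Suc.IH] by (simp only: funpow.simps)
qed

lemma rotation_power_one: "k < n \<Longrightarrow> (rotation n ^^ k) 1 = Suc k"
  by (induction k) (auto simp: rotation_def)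

text \<open>The image of one vertex and the direction determine all images, one vertex after the other.\<close>

lemma dihedral_eqI:
  assumes n: "n \<ge> 3" and gh: "g \<in> dihedral n" "h \<in> dihedral n" and one: "g 1 = h 1"
    and dir: "g 2 = g 1 mod n + 1 \<longleftrightarrow> h 2 = h 1 mod n + 1"
  shows "g = h"
proof -
  have two: "2 = (1::nat) mod n + 1" using n by simp
  have one_in: "1 \<in> {1..n}" using n by simp
  have forward: "(\<forall>i\<in>{1..n}. f (i mod n + 1) = f i mod n + 1)" if "f \<in> dihedral n" "f 2 = f 1 mod n + 1" for f
  proof (rule ccontr)
    assume "\<not> ?thesis"
    then have "f 1 = f (1 mod n + 1) mod n + 1" using dihedral_orientation[OF n that(1)] one_in by blast
    then have "f 1 = f 2 mod n + 1" by (simp only: two[symmetric])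
    then show False using that(2) cyclic_succ_twice[OF n dihedral_in[OF that(1) one_in]] by metis
  qed
  have backward: "(\<forall>i\<in>{1..n}. f i = f (i mod n + 1) mod n + 1)" if "f \<in> dihedral n" "f 2 \<noteq> f 1 mod n + 1" for f
  proof -
    have "f (1 mod n + 1) \<noteq> f 1 mod n + 1" unfolding two[symmetric] by (rule that(2))
    then show ?thesis using dihedral_orientation[OF n that(1)] one_in by blast
  qed
  have "g i = h i" if "i \<in> {1..n}" for i
  proof -
    have "1 \<le> i" using that by simp
    then show ?thesis using that
    proof (induction i rule: dec_induct)
      case base
      show ?case by (fact one)
    next
      case (step i)
      then have i: "i \<in> {1..n}" "i mod n + 1 = Suc i" and Suc_in: "Suc i \<in> {1..n}" by auto
      show ?case
      proof (cases "g 2 = g 1 mod n + 1")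
        case True
        then show ?thesis using forward[OF gh(1)] forward[OF gh(2)] dir i step.IH by metis
      next
        case False
        then have "g i = g (Suc i) mod n + 1" "h i = h (Suc i) mod n + 1"
          using backward[OF gh(1)] backward[OF gh(2)] dir i by metis+
        then have "g (Suc i) mod n + 1 = h (Suc i) mod n + 1" using step.IH[OF i(1)] by metis
        then show ?thesis
          using cyclic_succ_inj dihedral_in[OF gh(1) Suc_in] dihedral_in[OF gh(2) Suc_in] by blast
      qed
    qed
  qed
  moreover have "g i = h i" if "i \<notin> {1..n}" for i
    using permutes_not_in[OF dihedral_permutes[OF gh(1)] that]
      permutes_not_in[OF dihedral_permutes[OF gh(2)] that] by simp
  ultimately show ?thesis by blast
qed

lemma card_dihedral:
  assumes n: "n \<ge> 3" shows "card (dihedral n) = 2 * n"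
proof -
  let ?\<Phi> = "\<lambda>g. (g 1, g 2 = g 1 mod n + 1)"
  have inj: "inj_on ?\<Phi> (dihedral n)" using dihedral_eqI[OF n] by (auto intro!: inj_onI)
  have image: "?\<Phi> ` dihedral n = {1..n} \<times> UNIV"
  proof
    have "1 \<in> {1..n}" using n by simp
    then show "?\<Phi> ` dihedral n \<subseteq> {1..n} \<times> UNIV" using dihedral_in by blast
    show "{1..n} \<times> UNIV \<subseteq> ?\<Phi> ` dihedral n"
    proof clarify
      fix c :: nat and b :: bool assume c: "c \<in> {1..n}"
      show "(c, b) \<in> ?\<Phi> ` dihedral n"
      proof (cases b)
        case True
        define g where "g = rotation n ^^ (c - 1)"
        have g1: "g 1 = c" unfolding g_def using rotation_power_one[of "c - 1" n] c by auto
        have r1: "rotation n 1 = 2" using n by (simp add: rotation_def)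
        have "g 2 = g (rotation n 1)" unfolding r1 ..
        also have "\<dots> = rotation n (g 1)" unfolding g_def by (simp add: funpow_swap1)
        finally have "g 2 = c mod n + 1" using g1 c by (simp add: rotation_def)
        then show ?thesis
          using g1 True rotation_power_dihedral[where k = "c - 1" and n = n] unfolding g_def[symmetric]
          by (intro image_eqI[of _ _ g]) auto
      next
        case False
        define g where "g = (rotation n ^^ c) \<circ> reflection n"
        have g: "g \<in> dihedral n"
          unfolding g_def by (intro dihedral_comp rotation_power_dihedral reflection_dihedral)
        have c': "c = Suc (c - 1)" using c by simp
        have "(rotation n ^^ c) n = (rotation n ^^ (c - 1)) (rotation n n)"
          by (subst c') (simp only: funpow_Suc_right comp_apply)
        also have "rotation n n = 1" using n by (simp add: rotation_def)
        also have "(rotation n ^^ (c - 1)) 1 = c"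
          using rotation_power_one[of "c - 1" n] c by (auto simp del: One_nat_def)
        finally have rc: "(rotation n ^^ c) n = c" .
        have g1: "g 1 = c" using n rc by (simp add: g_def reflection_def)
        have "g 2 mod n + 1 = rotation n (g 2)"
          using dihedral_in[OF g, of 2] n by (simp add: rotation_def)
        also have "\<dots> = (rotation n ^^ c) (rotation n (n - 1))"
          using n by (simp add: g_def reflection_def funpow_swap1)
        also have "rotation n (n - 1) = n" using n by (simp add: rotation_def)
        finally have "g 2 mod n + 1 = c" using rc by simp
        then have "g 2 \<noteq> g 1 mod n + 1" using cyclic_succ_twice[OF n c] g1 by auto
        then show ?thesis using g1 g False by (intro image_eqI[of _ _ g]) auto
      qed
    qed
  qed
  have "card (dihedral n) = card ({1..n} \<times> (UNIV :: bool set))"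
    unfolding image[symmetric] by (rule card_image[OF inj, symmetric])
  then show ?thesis by (simp add: card_cartesian_product)
qed

section \<open>Relabelled triangulations and their average\<close>

text \<open>A relabelling by a symmetry of the cycle lists the same polygon again, in the same or in the
  opposite sense.\<close>

lemma convex_listing_relabel:
  assumes n: "n \<ge> 3" and poly: "convex_polygon n v P" and g: "g \<in> dihedral n"
  obtains \<epsilon> where "convex_listing n (v \<circ> g) P \<epsilon>"
proof -
  note perm = dihedral_permutes[OF g]
  have img: "(v \<circ> g) ` {1..n} = v ` {1..n}" by (simp only: image_comp[symmetric] permutes_image[OF perm])
  have inj: "inj_on (v \<circ> g) {1..n}"
    using poly perm permutes_image[OF perm] permutes_inj_on[OF perm]
    by (auto simp: convex_polygon_def intro!: comp_inj_on)
  have left: "0 \<le> signed_area (v i) (v (i mod n + 1)) x" if "i \<in> {1..n}" "x \<in> P" for i x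
    using poly that by (simp add: convex_polygon_def)
  have hull: "P = convex hull ((v \<circ> g) ` {1..n})" "{x. x extreme_point_of P} = (v \<circ> g) ` {1..n}"
    using poly unfolding img convex_polygon_def by blast+
  show ?thesis
  proof (cases "\<forall>i\<in>{1..n}. g (i mod n + 1) = g i mod n + 1")
    case True
    have "convex_listing n (v \<circ> g) P 1"
    proof
      fix i x assume "i \<in> {1..n}" "x \<in> P"
      then show "0 \<le> 1 * signed_area ((v \<circ> g) i) ((v \<circ> g) (i mod n + 1)) x"
        using True left[OF dihedral_in[OF g]] by simp
    qed (use n inj hull in auto)
    then show ?thesis by (rule that)
  next
    case False
    then have bwd: "g i = g (i mod n + 1) mod n + 1" if "i \<in> {1..n}" for i
      using dihedral_orientation[OF n g] that by blast
    have "convex_listing n (v \<circ> g) P (-1)"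
    proof
      fix i x assume i: "i \<in> {1..n}" and x: "x \<in> P"
      have "0 \<le> signed_area (v (g (i mod n + 1))) (v (g i)) x"
        using left[OF dihedral_in[OF g cyclic_succ_in[OF i]] x] bwd[OF i] by simp
      also have "\<dots> = - signed_area (v (g i)) (v (g (i mod n + 1))) x"
        by (simp add: signed_area_eq algebra_simps)
      finally show "0 \<le> -1 * signed_area ((v \<circ> g) i) ((v \<circ> g) (i mod n + 1)) x" by simp
    qed (use n inj hull in auto)
    then show ?thesis by (rule that)
  qed
qed

text \<open>The ends of the second chord lie strictly on different sides of the first. The point where it
  meets the line of the first chord belongs to the polygon, hence to the first chord itself, and
  it differs from the ends because they are extreme.\<close>

lemma (in convex_listing) interleaved_chords_meet:
  assumes "1 \<le> a" "a < c" "c < b" "b < d" "d \<le> n"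
  shows "rel_interior (closed_segment (u a) (u b)) \<inter> rel_interior (closed_segment (u c) (u d)) \<noteq> {}"
proof -
  have ne: "u a \<noteq> u b" "u c \<noteq> u d" "u a \<noteq> u c" "u a \<noteq> u d" "u b \<noteq> u c" "u b \<noteq> u d"
    using assms inj by (auto dest!: inj_onD)
  have neg: "side a b (u c) < 0" and pos: "side a b (u d) > 0"
    using side_inside[of a c b] side_outside[of a b d] assms by auto
  define t where "t = - side a b (u c) / (side a b (u d) - side a b (u c))"
  define w where "w = (1 - t) *\<^sub>R u c + t *\<^sub>R u d"
  have t: "0 < t" "t < 1" using neg pos by (auto simp: t_def field_simps)
  have "side a b w = side a b (u c) + t * (side a b (u d) - side a b (u c))"
    unfolding w_def side_segment by (simp add: algebra_simps)
  then have zero: "side a b w = 0" using neg pos by (simp add: t_def)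
  have w_cd: "w \<in> open_segment (u c) (u d)" using t ne w_def by (auto simp: in_segment)
  have cd: "u c \<in> P" "u d \<in> P" using assms vertex_in by auto
  have "w \<in> P" unfolding w_def using cd t by (intro convexD) (auto simp: hull)
  then have w_ab: "w \<in> closed_segment (u a) (u b)"
    using assms zero by (intro line_inter_polygon) auto
  have "w \<noteq> u a" "w \<noteq> u b"
    using vertex_extreme[of a "u c" "u d"] vertex_extreme[of b "u c" "u d"] cd w_cd assms ne
    by (auto simp: open_segment_def)
  then have "w \<in> open_segment (u a) (u b)" using w_ab by (simp add: open_segment_def)
  then show ?thesis using w_cd ne by (auto simp: rel_interior_closed_segment)
qed

lemma coordinate_system_average:
  assumes D: "finite D" "D \<noteq> {}" and sys: "\<And>g. g \<in> D \<Longrightarrow> coordinate_system P V (l g)"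
  shows "coordinate_system P V (\<lambda>w x. 1 / real (card D) * (\<Sum>g\<in>D. l g w x))"
proof -
  have N: "real (card D) > 0" using D by (simp add: card_gt_0_iff)
  have range: "1 / real (card D) * (\<Sum>g\<in>D. l g w a) \<in> {0..1}" if wa: "w \<in> V" "a \<in> P" for w a
  proof -
    have l: "0 \<le> l g w a" "l g w a \<le> 1" if "g \<in> D" for g
      using sys[OF that] wa unfolding coordinate_system_def by fastforce+
    have "(\<Sum>g\<in>D. l g w a) \<le> real (card D)" using sum_bounded_above[of D "\<lambda>g. l g w a" 1] l by simp
    moreover have "0 \<le> (\<Sum>g\<in>D. l g w a)" using l by (intro sum_nonneg)
    ultimately show ?thesis using N by (simp add: field_simps)
  qed
  have sums: "(\<Sum>w\<in>V. 1 / real (card D) * (\<Sum>g\<in>D. l g w a)) = 1 \<and>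
      a = (\<Sum>w\<in>V. (1 / real (card D) * (\<Sum>g\<in>D. l g w a)) *\<^sub>R w)" if a: "a \<in> P" for a
  proof
    have l: "(\<Sum>w\<in>V. l g w a) = 1" "(\<Sum>w\<in>V. l g w a *\<^sub>R w) = a" if "g \<in> D" for g
      using sys[OF that] a unfolding coordinate_system_def by auto
    have "(\<Sum>w\<in>V. 1 / real (card D) * (\<Sum>g\<in>D. l g w a)) = 1 / real (card D) * (\<Sum>g\<in>D. \<Sum>w\<in>V. l g w a)"
      by (subst sum.swap) (simp add: sum_distrib_left)
    also have "\<dots> = 1" using l N by simp
    finally show "(\<Sum>w\<in>V. 1 / real (card D) * (\<Sum>g\<in>D. l g w a)) = 1" .
    have "(\<Sum>w\<in>V. (1 / real (card D) * (\<Sum>g\<in>D. l g w a)) *\<^sub>R w)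
        = (1 / real (card D)) *\<^sub>R (\<Sum>w\<in>V. \<Sum>g\<in>D. l g w a *\<^sub>R w)"
      by (simp only: scaleR_sum_left[symmetric] scaleR_sum_right scaleR_scaleR)
    also have "\<dots> = (1 / real (card D)) *\<^sub>R (\<Sum>g\<in>D. \<Sum>w\<in>V. l g w a *\<^sub>R w)"
      by (subst sum.swap) (rule refl)
    also have "\<dots> = (1 / real (card D)) *\<^sub>R (\<Sum>g\<in>D. a)" using l by simp
    also have "\<dots> = a" using N by (simp only: sum_constant_scaleR scaleR_scaleR) simp
    finally show "a = (\<Sum>w\<in>V. (1 / real (card D) * (\<Sum>g\<in>D. l g w a)) *\<^sub>R w)" by simp
  qed
  show ?thesis unfolding coordinate_system_def using range sums by auto
qed

definition index_chords :: "nat \<Rightarrow> (nat \<Rightarrow> point) \<Rightarrow> point set set \<Rightarrow> (nat \<times> nat) set" where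
  "index_chords n v \<delta> = {(a, b). 1 \<le> a \<and> a < b \<and> b \<le> n \<and> closed_segment (v a) (v b) \<in> \<delta>}"

lemma index_chords_range:
  assumes inj: "inj_on v {1..n}" and \<delta>: "\<delta> \<subseteq> chords n v" and ab: "(a, b) \<in> index_chords n v \<delta>"
  shows "1 \<le> a \<and> a + 2 \<le> b \<and> b \<le> n \<and> (a, b) \<noteq> (1, n)"
proof -
  have r: "1 \<le> a" "a < b" "b \<le> n" and mem: "closed_segment (v a) (v b) \<in> chords n v"
    using ab \<delta> by (auto simp: index_chords_def)
  obtain j k where jk: "j \<in> {1..n}" "k \<in> {1..n}" "\<not> cycle_adjacent n j k"
    "closed_segment (v a) (v b) = closed_segment (v j) (v k)"
    using mem by (auto simp: chords_def)
  then have "{v a, v b} = {v j, v k}" by simp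
  then have "a = j \<and> b = k \<or> a = k \<and> b = j"
    using r jk inj by (auto simp: doubleton_eq_iff dest: inj_onD)
  then have "\<not> cycle_adjacent n a b" using jk by (auto simp: cycle_adjacent_def)
  then show ?thesis using r by (auto simp: cycle_adjacent_def)
qed

lemma card_index_chords:
  assumes inj: "inj_on v {1..n}" and \<delta>: "\<delta> \<subseteq> chords n v"
  shows "card (index_chords n v \<delta>) = card \<delta>"
proof -
  let ?f = "\<lambda>(a, b). closed_segment (v a) (v b)"
  have "inj_on ?f (index_chords n v \<delta>)"
  proof (rule inj_onI, clarify)
    fix a b c d assume ab: "(a, b) \<in> index_chords n v \<delta>" and cd: "(c, d) \<in> index_chords n v \<delta>"
      and "closed_segment (v a) (v b) = closed_segment (v c) (v d)"
    then have "{v a, v b} = {v c, v d}" by simp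
    moreover have "a \<in> {1..n}" "b \<in> {1..n}" "c \<in> {1..n}" "d \<in> {1..n}" "a < b" "c < d"
      using ab cd by (auto simp: index_chords_def)
    ultimately show "a = c \<and> b = d"
      by (auto simp: doubleton_eq_iff inj_on_eq_iff[OF inj])
  qed
  moreover have "?f ` index_chords n v \<delta> = \<delta>"
  proof
    show "?f ` index_chords n v \<delta> \<subseteq> \<delta>" by (auto simp: index_chords_def)
    show "\<delta> \<subseteq> ?f ` index_chords n v \<delta>"
    proof
      fix c assume c: "c \<in> \<delta>"
      then obtain j k where jk: "j \<in> {1..n}" "k \<in> {1..n}" "j \<noteq> k" "c = closed_segment (v j) (v k)"
        using \<delta> by (auto simp: chords_def)
      then have "(min j k, max j k) \<in> index_chords n v \<delta>" "c = ?f (min j k, max j k)"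
        using c by (auto simp: index_chords_def min_def max_def closed_segment_commute)
      then show "c \<in> ?f ` index_chords n v \<delta>" by blast
    qed
  qed
  ultimately show ?thesis by (metis card_image)
qed

text \<open>Moving the chords and keeping the vertices gives the same segments as keeping the index pairs
  and relabelling the vertices.\<close>

lemma act_eq:
  assumes inj: "inj_on v {1..n}" and \<delta>: "\<delta> \<subseteq> chords n v"
  shows "act n v \<delta> g = {closed_segment ((v \<circ> g) a) ((v \<circ> g) b) | a b. (a, b) \<in> index_chords n v \<delta>}"
proof
  show "act n v \<delta> g \<subseteq> {closed_segment ((v \<circ> g) a) ((v \<circ> g) b) | a b. (a, b) \<in> index_chords n v \<delta>}"
  proof
    fix c assume "c \<in> act n v \<delta> g"
    then obtain j k where jk: "j \<in> {1..n}" "k \<in> {1..n}" "closed_segment (v j) (v k) \<in> \<delta>"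
      and c: "c = closed_segment (v (g j)) (v (g k))" by (auto simp: act_def)
    have "j \<noteq> k"
    proof
      assume "j = k"
      moreover obtain p q where "p \<in> {1..n}" "q \<in> {1..n}" "p \<noteq> q"
        "closed_segment (v j) (v k) = closed_segment (v p) (v q)"
        using jk \<delta> by (auto simp: chords_def)
      ultimately have "{v j} = {v p, v q}" "p \<in> {1..n}" "q \<in> {1..n}" "p \<noteq> q"
        using closed_segment_eq[of "v j" "v k" "v p" "v q"] by auto
      then show False using inj_onD[OF inj, of p q] by (auto simp: doubleton_eq_iff)
    qed
    then have "(min j k, max j k) \<in> index_chords n v \<delta>"
      "c = closed_segment ((v \<circ> g) (min j k)) ((v \<circ> g) (max j k))"
      using jk c by (auto simp: index_chords_def min_def max_def closed_segment_commute)
    then show "c \<in> {closed_segment ((v \<circ> g) a) ((v \<circ> g) b) | a b. (a, b) \<in> index_chords n v \<delta>}"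
      by blast
  qed
  show "{closed_segment ((v \<circ> g) a) ((v \<circ> g) b) | a b. (a, b) \<in> index_chords n v \<delta>} \<subseteq> act n v \<delta> g"
    by (fastforce simp: act_def index_chords_def)
qed

lemma index_chords_noncrossing:
  assumes n: "n \<ge> 3" and poly: "convex_polygon n v P"
    and disj: "pairwise (\<lambda>c d. rel_interior c \<inter> rel_interior d = {}) \<delta>"
  shows "noncrossing (index_chords n v \<delta>)"
proof -
  interpret convex_listing n v P 1
    using n poly by unfold_locales (auto simp: convex_polygon_def)
  show ?thesis
    unfolding noncrossing_def
  proof clarify
    fix a b c d assume ab: "(a, b) \<in> index_chords n v \<delta>" and cd: "(c, d) \<in> index_chords n v \<delta>"
      and order: "a < c" "c < b" "b < d"
    let ?ab = "closed_segment (v a) (v b)" and ?cd = "closed_segment (v c) (v d)"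
    have r: "1 \<le> a" "d \<le> n" "?ab \<in> \<delta>" "?cd \<in> \<delta>" using ab cd by (auto simp: index_chords_def)
    have "?ab \<noteq> ?cd"
      using r order inj by (auto simp: doubleton_eq_iff dest: inj_onD)
    then show False
      using pairwiseD[OF disj r(3,4)] interleaved_chords_meet[of a c b d] r order by simp
  qed
qed

text \<open>The number of the chords and their not crossing are properties of the index pairs, so they
  pass over to the relabelled polygon, where they produce a triangulation.\<close>

lemma act_coordinate_system:
  assumes n: "n \<ge> 3" and poly: "convex_polygon n v P" and \<delta>: "chordal_decomposition n v P \<delta>"
    and g: "g \<in> dihedral n"
  shows "coordinate_system P (v ` {1..n}) (chordal_coord P (act n v \<delta> g))"
proof -
  have sub: "\<delta> \<subseteq> chords n v" and card: "card \<delta> = n - 3"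
    and disj: "pairwise (\<lambda>c d. rel_interior c \<inter> rel_interior d = {}) \<delta>"
    using \<delta> by (auto simp: chordal_decomposition_def)
  have inj_v: "inj_on v {1..n}" using poly by (simp add: convex_polygon_def)
  obtain \<epsilon> where "convex_listing n (v \<circ> g) P \<epsilon>" using convex_listing_relabel[OF n poly g] .
  then interpret convex_listing n "v \<circ> g" P \<epsilon> .
  interpret triangulated_listing n "v \<circ> g" P \<epsilon> "index_chords n v \<delta>"
    by unfold_locales
      (use index_chords_range[OF inj_v sub] index_chords_noncrossing[OF n poly disj]
        card_index_chords[OF inj_v sub] card in auto)
  have "(v \<circ> g) ` {1..n} = v ` {1..n}"
    by (simp only: image_comp[symmetric] permutes_image[OF dihedral_permutes[OF g]])
  then show ?thesis
    using chordal_coordinate_system unfolding act_eq[OF inj_v sub] chord_segments_def by simp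
qed

theorem theorem5p2:
  fixes n :: nat and v :: "nat \<Rightarrow> real^2" and P :: "(real^2) set"
    and \<delta> :: "(real^2) set set"
  assumes "n \<ge> 3"
    and "convex_polygon n v P"
    and "chordal_decomposition n v P \<delta>"
  shows "coordinate_system P (v ` {1..n}) (cartographic n v P \<delta>)"
proof -
  have card: "card (dihedral n) = 2 * n" using card_dihedral assms(1) .
  then have "finite (dihedral n)" "dihedral n \<noteq> {}"
    using assms(1) by (auto intro: card_ge_0_finite)
  then have "coordinate_system P (v ` {1..n})
      (\<lambda>w x. 1 / real (card (dihedral n)) * (\<Sum>g\<in>dihedral n. chordal_coord P (act n v \<delta> g) w x))"
    by (rule coordinate_system_average) (rule act_coordinate_system[OF assms])
  moreover have "cartographic n v P \<delta> =
      (\<lambda>w x. 1 / real (card (dihedral n)) * (\<Sum>g\<in>dihedral n. chordal_coord P (act n v \<delta> g) w x))"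
    by (intro ext) (simp add: cartographic_def card)
  ultimately show ?thesis by simp
qed

end
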